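(* Let $\delta\in\mathbb{C}$. Let $\times\in\mathscr{P}(2,2)$ be the partition with blocks $\{1,2'\},\{2,1'\}$ and let $b\in\mathscr{P}(2,2)$ be the partition with the single block $\{1,2,1',2'\}$. Then the linear category of partitions $\mathscr{K}:=\langle 2b-\times\rangle_\delta$ is isomorphic to $\langle\times\rangle_\delta$. Moreover, $\mathscr{K}$ is non-easy.
   Context: For $k,l\in\mathbb{N}_0$ let $\mathscr{P}(k,l)$ be the set of set partitions of $k$ upper points $1,\dots,k$ and $l$ lower points $1',\dots,l'$ (both ordered left to right). For $\delta\in\mathbb{C}$ let $\mathbf{Part}_\delta(k,l)$ be the complex vector space with basis $\mathscr{P}(k,l)$. Category operations: (i) tensor product $p\otimes q$: place $p$ and $q$ side by side ($p$ on the left), extended bilinearly; (ii) composition: for $p\in\mathscr{P}(k,l)$, $q\in\mathscr{P}(l,m)$, identify the lower points of $p$ with the upper points of $q$, let $r\in\mathscr{P}(k,m)$ be the induced partition on the upper points of $p$ and lower points of $q$, and put $qp=\delta^{c}r$, where $c$ is the number of connected components consisting only of middle points; extended bilinearly; (iii) involution $p\mapsto p^*$: interchange the upper and lower rows, extended antilinearly. A linear category of partitions is a collection of subspaces $\mathscr{K}(k,l)\subseteq\mathbf{Part}_\delta(k,l)$ containing the identity partition $\{1,1'\}\in\mathscr{P}(1,1)$ and the pair partition $\{1',2'\}\in\mathscr{P}(0,2)$ and closed under the category operations. $\langle p_1,\dots,p_n\rangle_\delta$ is the smallest linear category of partitions containing $p_1,\dots,p_n$. $\mathscr{K}$ is easy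 if for all $k,l$ there is a set $\mathscr{C}(k,l)\subseteq\mathscr{P}(k,l)$ with $\mathscr{K}(k,l)=\operatorname{span}\mathscr{C}(k,l)$; otherwise non-easy. Isomorphic means: there is a monoidal $*$-isomorphism, i.e. a family of linear bijections between the morphism spaces with the same $(k,l)$, compatible with tensor product, composition and involution. (The category $\langle\times\rangle_\delta$ is the span of all partitions all of whose blocks have size two.) *)

theory Defs
  imports Complex_Main "HOL-Library.Disjoint_Sets" "HOL-Library.Poly_Mapping"
begin

section \<open>Set partitions of upper and lower points\<close>

text \<open>The upper point \<open>i\<close> is \<open>Inl i\<close> and the lower point \<open>j'\<close> is \<open>Inr j\<close>; both rows are numbered
  from 1, from left to right.\<close>

type_synonym two_row = "(nat + nat) set set"

definition partitions :: "nat \<Rightarrow> nat \<Rightarrow> two_row set" where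
  "partitions k l = {p. partition_on ({1..k} <+> {1..l}) p}"

text \<open>The parameters \<open>k\<close> and \<open>l\<close> are the numbers of upper and lower points of \<open>p\<close>.\<close>

definition tensor_partition :: "nat \<Rightarrow> nat \<Rightarrow> two_row \<Rightarrow> two_row \<Rightarrow> two_row" where
  "tensor_partition k l p q = p \<union> (`) (map_sum ((+) k) ((+) l)) ` q"

definition invol_partition :: "two_row \<Rightarrow> two_row" where
  "invol_partition p = (`) (case_sum Inr Inl) ` p"

text \<open>Stacking \<open>q\<close> below \<open>p\<close>. In \<open>nat + (nat + nat)\<close> the points \<open>Inl i\<close> are the upper points of \<open>p\<close>,
  the points \<open>Inr (Inl j)\<close> are the lower points of \<open>p\<close> identified with the upper points of \<open>q\<close>, and the
  points \<open>Inr (Inr m)\<close> are the lower points of \<open>q\<close>.\<close>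

definition stack :: "two_row \<Rightarrow> two_row \<Rightarrow> (nat + (nat + nat)) set set" where
  "stack q p = (`) (map_sum id Inl) ` p \<union> (`) Inr ` q"

definition components :: "two_row \<Rightarrow> two_row \<Rightarrow> (nat + (nat + nat)) set set" where
  "components q p = \<Union>(stack q p) // (\<Union>B\<in>stack q p. B \<times> B)\<^sup>+"

definition comp_partition :: "two_row \<Rightarrow> two_row \<Rightarrow> two_row" where
  "comp_partition q p = (\<lambda>C. map_sum id Inr -` C) ` components q p - {{}}"

definition loops :: "two_row \<Rightarrow> two_row \<Rightarrow> nat" where
  "loops q p = card {C \<in> components q p. C \<subseteq> range (Inr \<circ> Inl)}"


section \<open>The spaces \<open>Part\<^sub>\<delta>(k,l)\<close> and the category operations\<close>

text \<open>All formal linear combinations of partitions live in one type; those of elements of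
  \<open>partitions k l\<close> form the space \<open>Part k l\<close>.\<close>

type_synonym lincomb = "two_row \<Rightarrow>\<^sub>0 complex"

definition Part :: "nat \<Rightarrow> nat \<Rightarrow> lincomb set" where
  "Part k l = {f. Poly_Mapping.keys f \<subseteq> partitions k l}"

abbreviation basis :: "two_row \<Rightarrow> lincomb" where
  "basis p \<equiv> Poly_Mapping.single p 1"

definition scale :: "complex \<Rightarrow> lincomb \<Rightarrow> lincomb" where
  "scale c f = Poly_Mapping.map ((*) c) f"

lemma lookup_scale [simp]: "Poly_Mapping.lookup (scale c f) p = c * Poly_Mapping.lookup f p"
  by (simp add: scale_def Poly_Mapping.map.rep_eq when_def)

interpretation lincomb: vector_space scale
  by unfold_locales (auto intro!: poly_mapping_eqI simp: lookup_add algebra_simps)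

definition tensor :: "nat \<Rightarrow> nat \<Rightarrow> lincomb \<Rightarrow> lincomb \<Rightarrow> lincomb" where
  "tensor k l f g = (\<Sum>p\<in>Poly_Mapping.keys f. \<Sum>q\<in>Poly_Mapping.keys g.
     scale (Poly_Mapping.lookup f p * Poly_Mapping.lookup g q) (basis (tensor_partition k l p q)))"

text \<open>\<open>composition \<delta> g f\<close> is the composition \<open>gf\<close>, with \<open>f\<close> on top of \<open>g\<close>.\<close>

definition composition :: "complex \<Rightarrow> lincomb \<Rightarrow> lincomb \<Rightarrow> lincomb" where
  "composition \<delta> g f = (\<Sum>p\<in>Poly_Mapping.keys f. \<Sum>q\<in>Poly_Mapping.keys g.
     scale (Poly_Mapping.lookup g q * Poly_Mapping.lookup f p)
       (scale (\<delta> ^ loops q p) (basis (comp_partition q p))))"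

definition invol :: "lincomb \<Rightarrow> lincomb" where
  "invol f = (\<Sum>p\<in>Poly_Mapping.keys f.
     scale (cnj (Poly_Mapping.lookup f p)) (basis (invol_partition p)))"


section \<open>Linear categories of partitions\<close>

text \<open>The empty partition is not required to lie in \<open>K 0 0\<close>. For \<open>\<delta> \<noteq> 0\<close> it does so anyway, being a
  multiple of the composition of the pair partition with its involution.\<close>

definition linear_category :: "complex \<Rightarrow> (nat \<Rightarrow> nat \<Rightarrow> lincomb set) \<Rightarrow> bool" where
  "linear_category \<delta> K \<longleftrightarrow>
     (\<forall>k l. K k l \<subseteq> Part k l \<and> lincomb.subspace (K k l)) \<and>
     basis {{Inl 1, Inr 1}} \<in> K 1 1 \<and>
     basis {{Inr 1, Inr 2}} \<in> K 0 2 \<and>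
     (\<forall>k l k' l'. \<forall>f\<in>K k l. \<forall>g\<in>K k' l'. tensor k l f g \<in> K (k + k') (l + l')) \<and>
     (\<forall>k l m. \<forall>f\<in>K k l. \<forall>g\<in>K l m. composition \<delta> g f \<in> K k m) \<and>
     (\<forall>k l. \<forall>f\<in>K k l. invol f \<in> K l k)"

text \<open>The smallest linear category containing the given generators, where \<open>G k l \<subseteq> Part k l\<close> is the
  set of generators with \<open>k\<close> upper and \<open>l\<close> lower points.\<close>

definition generated ::
  "complex \<Rightarrow> (nat \<Rightarrow> nat \<Rightarrow> lincomb set) \<Rightarrow> nat \<Rightarrow> nat \<Rightarrow> lincomb set" where
  "generated \<delta> G k l = \<Inter>{K k l | K. linear_category \<delta> K \<and> (\<forall>k' l'. G k' l' \<subseteq> K k' l')}"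

definition generated_by ::
  "complex \<Rightarrow> nat \<Rightarrow> nat \<Rightarrow> lincomb \<Rightarrow> nat \<Rightarrow> nat \<Rightarrow> lincomb set" where
  "generated_by \<delta> k l f = generated \<delta> (\<lambda>k' l'. if k' = k \<and> l' = l then {f} else {})"

definition easy :: "(nat \<Rightarrow> nat \<Rightarrow> lincomb set) \<Rightarrow> bool" where
  "easy K \<longleftrightarrow> (\<forall>k l. \<exists>C \<subseteq> partitions k l. K k l = lincomb.span (basis ` C))"

definition isomorphic ::
  "complex \<Rightarrow> (nat \<Rightarrow> nat \<Rightarrow> lincomb set) \<Rightarrow> (nat \<Rightarrow> nat \<Rightarrow> lincomb set) \<Rightarrow> bool" where
  "isomorphic \<delta> K L \<longleftrightarrow> (\<exists>\<phi>.
     (\<forall>k l. bij_betw (\<phi> k l) (K k l) (L k l)) \<and>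
     (\<forall>k l. \<forall>f\<in>K k l. \<forall>g\<in>K k l. \<phi> k l (f + g) = \<phi> k l f + \<phi> k l g) \<and>
     (\<forall>k l c. \<forall>f\<in>K k l. \<phi> k l (scale c f) = scale c (\<phi> k l f)) \<and>
     (\<forall>k l k' l'. \<forall>f\<in>K k l. \<forall>g\<in>K k' l'.
        \<phi> (k + k') (l + l') (tensor k l f g) = tensor k l (\<phi> k l f) (\<phi> k' l' g)) \<and>
     (\<forall>k l m. \<forall>f\<in>K k l. \<forall>g\<in>K l m.
        \<phi> k m (composition \<delta> g f) = composition \<delta> (\<phi> l m g) (\<phi> k l f)) \<and>
     (\<forall>k l. \<forall>f\<in>K k l. \<phi> l k (invol f) = invol (\<phi> k l f)))"

definition crossing :: two_row where
  "crossing = {{Inl 1, Inr 2}, {Inl 2, Inr 1}}"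

definition four_block :: two_row where
  "four_block = {{Inl 1, Inl 2, Inr 1, Inr 2}}"

end

theory Submission
  imports Defs "HOL-Computational_Algebra.Polynomial"
begin

text \<open>Colour the points by natural numbers and let a partition act as the indicator of the colourings
  that are constant on its blocks; by Moebius inversion this identifies \<open>Part k l\<close> with the functions
  of colourings that depend only on which points have equal colours. On elements supported on
  colourings with all colour classes even, multiply by the sign
  \<open>(-1)\<close> to the number of inversions of the upper row plus that of the lower row.
  This depends only on the kernel of the colouring and is an involutive automorphism \<open>twist\<close>: for
  composition, the inversions of the middle row occur twice and cancel. It multiplies a
  pair partition by \<open>-1\<close> for each crossing of differently coloured strings, so it exchanges
  \<open>\<times>\<close> and \<open>2b - \<times>\<close>, hence the categories they generate.

  If the twisted category were easy, it would contain \<open>b\<close>, which is fixed by \<open>twist\<close>; then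
  \<open>b\<close> would lie in \<open>\<langle>\<times>\<rangle>\<close>, whose elements are combinations of pair partitions.\<close>

section \<open>Linear combinations of partitions as functions of colourings\<close>

definition supported :: "two_row set \<Rightarrow> lincomb set" where
  "supported S = {f. Poly_Mapping.keys f \<subseteq> S}"

lemma Part_eq_supported: "Part k l = supported (partitions k l)"
  by (simp add: Part_def supported_def)

lemma keys_scale_subset: "Poly_Mapping.keys (scale c f) \<subseteq> Poly_Mapping.keys f"
  by (auto simp: in_keys_iff)

lemma subspace_supported: "lincomb.subspace (supported S)"
proof (rule lincomb.subspaceI)
  show "f + g \<in> supported S" if "f \<in> supported S" "g \<in> supported S" for f g
    using that keys_add[of f g] by (auto simp: supported_def)
  show "scale c f \<in> supported S" if "f \<in> supported S" for c f
    using that keys_scale_subset[of c f] by (auto simp: supported_def)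
qed (simp add: supported_def)

lemma scale_basis_in_supported: "p \<in> S \<Longrightarrow> scale c (basis p) \<in> supported S"
  using keys_scale_subset[of c "basis p"] by (auto simp: supported_def split: if_splits)

lemma basis_in_supported_iff [simp]: "basis p \<in> supported S \<longleftrightarrow> p \<in> S"
  by (auto simp: supported_def)

text \<open>Closure of a span of partitions under a bilinear operation reduces to closure of the
  partitions themselves. This lemma and its analogues for composition and involution serve both
  \<open>Part\<close> and the pair partitions.\<close>

lemma tensor_in_supported:
  assumes "f \<in> supported S" "g \<in> supported S'"
    and "\<And>p q. p \<in> S \<Longrightarrow> q \<in> S' \<Longrightarrow> tensor_partition k l p q \<in> S''"
  shows "tensor k l f g \<in> supported S''"
  unfolding tensor_def using assms
  by (intro lincomb.subspace_sum subspace_supported scale_basis_in_supported) (auto simp: supported_def)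

lemma composition_in_supported:
  assumes "f \<in> supported S" "g \<in> supported S'"
    and "\<And>p q. p \<in> S \<Longrightarrow> q \<in> S' \<Longrightarrow> comp_partition q p \<in> S''"
  shows "composition \<delta> g f \<in> supported S''"
  unfolding composition_def using assms
  by (intro lincomb.subspace_sum lincomb.subspace_scale subspace_supported scale_basis_in_supported)
    (auto simp: supported_def)

lemma invol_in_supported:
  assumes "f \<in> supported S" and "\<And>p. p \<in> S \<Longrightarrow> invol_partition p \<in> S'"
  shows "invol f \<in> supported S'"
  unfolding invol_def using assms
  by (intro lincomb.subspace_sum subspace_supported scale_basis_in_supported) (auto simp: supported_def)

section \<open>Evaluation of linear combinations on colourings\<close>

definition compatible :: "('a \<Rightarrow> 'b) \<Rightarrow> 'a set set \<Rightarrow> bool" where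
  "compatible i p \<longleftrightarrow> (\<forall>B\<in>p. \<forall>x\<in>B. \<forall>y\<in>B. i x = i y)"

text \<open>Restricted to colours below \<open>N\<close>, these are the entries of the linear map
  between tensor powers of an \<open>N\<close>-dimensional space attached to \<open>f\<close>, the
  colours of the two rows being the multi-indices. With all naturals as colours, every kernel
  occurs.\<close>

definition ev :: "lincomb \<Rightarrow> (nat + nat \<Rightarrow> nat) \<Rightarrow> complex" where
  "ev f i = (\<Sum>p\<in>Poly_Mapping.keys f. Poly_Mapping.lookup f p * of_bool (compatible i p))"

lemma ev_superset:
  assumes "finite A" "Poly_Mapping.keys f \<subseteq> A"
  shows "ev f i = (\<Sum>p\<in>A. Poly_Mapping.lookup f p * of_bool (compatible i p))"
  unfolding ev_def using assms by (intro sum.mono_neutral_left) (auto simp: in_keys_iff)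

lemma ev_add: "ev (f + g) i = ev f i + ev g i"
proof -
  let ?A = "Poly_Mapping.keys f \<union> Poly_Mapping.keys g"
  have "ev h i = (\<Sum>p\<in>?A. Poly_Mapping.lookup h p * of_bool (compatible i p))"
    if "h \<in> {f, g, f + g}" for h
    using that keys_add[of f g] by (intro ev_superset) auto
  then show ?thesis
    by (simp add: lookup_add sum.distrib algebra_simps)
qed

lemma ev_scale: "ev (scale c f) i = c * ev f i"
  by (subst ev_superset[OF finite_keys keys_scale_subset]) (simp only: ev_def sum_distrib_left lookup_scale mult.assoc)

lemma ev_0 [simp]: "ev 0 i = 0"
  by (simp add: ev_def)

lemma ev_sum: "ev (\<Sum>x\<in>A. f x) i = (\<Sum>x\<in>A. ev (f x) i)"
  by (induction A rule: infinite_finite_induct) (auto simp: ev_add)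

lemma ev_diff: "ev (f - g) i = ev f i - ev g i"
  using ev_add[of "f - g" g i] by simp

lemma ev_basis: "ev (basis p) i = of_bool (compatible i p)"
  by (simp add: ev_def)

section \<open>Moebius inversion over the kernels of colourings\<close>

lemma triangular_solvable:
  fixes G :: "'a \<Rightarrow> 'b::ring_1" and h :: "'a \<Rightarrow> nat"
  assumes "finite P" "\<And>x. x \<in> P \<Longrightarrow> R x x"
    and "\<And>x y. x \<in> P \<Longrightarrow> y \<in> P \<Longrightarrow> R x y \<Longrightarrow> x \<noteq> y \<Longrightarrow> h x < h y"
  shows "\<exists>f. \<forall>y\<in>P. (\<Sum>x\<in>P. f x * of_bool (R x y)) = G y"
  using assms
proof (induction P rule: finite_ranking_induct[where f = h])
  case (insert z S)
  show ?case
  proof (cases "z \<in> S")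
    case False
    obtain f where f: "\<And>y. y \<in> S \<Longrightarrow> (\<Sum>x\<in>S. f x * of_bool (R x y)) = G y"
      using insert by fastforce
    \<comment> \<open>Since \<open>z\<close> has maximal rank, \<open>R z y\<close> fails for every
      \<open>y\<close> in \<open>S\<close>. Hence the coefficient at \<open>z\<close> can be chosen
      to satisfy the equation at \<open>z\<close> without disturbing the equations already
      solved.\<close>
    define f' where "f' = f(z := G z - (\<Sum>x\<in>S. f x * of_bool (R x z)))"
    have "(\<Sum>x\<in>S. f' x * of_bool (R x y)) = (\<Sum>x\<in>S. f x * of_bool (R x y))" for y
      using False by (intro sum.cong) (auto simp: f'_def)
    moreover have "\<not> R z y" if "y \<in> S" for y
      using insert.prems(2)[of z y] insert.hyps(2)[OF that] that False by force
    ultimately have "\<forall>y\<in>insert z S. (\<Sum>x\<in>insert z S. f' x * of_bool (R x y)) = G y"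
      using False insert.hyps(1) insert.prems(1)[of z] f by (auto simp: f'_def)
    then show ?thesis by blast
  qed (use insert in \<open>simp add: insert_absorb\<close>)
qed auto

lemma triangular_unique:
  fixes f :: "'a \<Rightarrow> 'b::ring_1" and h :: "'a \<Rightarrow> nat"
  assumes "finite P" and refl: "\<And>x. x \<in> P \<Longrightarrow> R x x"
    and lt: "\<And>x y. x \<in> P \<Longrightarrow> y \<in> P \<Longrightarrow> R x y \<Longrightarrow> x \<noteq> y \<Longrightarrow> h x < h y"
    and zero: "\<And>y. y \<in> P \<Longrightarrow> (\<Sum>x\<in>P. f x * of_bool (R x y)) = 0"
  shows "y \<in> P \<Longrightarrow> f y = 0"
proof (induction "h y" arbitrary: y rule: less_induct)
  case less
  \<comment> \<open>Any other \<open>x\<close> with \<open>R x y\<close> has smaller rank, so its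
    coefficient vanishes by induction.\<close>
  have "(\<Sum>x\<in>P. f x * of_bool (R x y)) = (\<Sum>x\<in>{y}. f x * of_bool (R x y))"
    using assms(1) less lt[of _ y] by (intro sum.mono_neutral_right) auto
  then show ?case
    using zero[OF less.prems] refl[OF less.prems] by simp
qed

abbreviation points :: "nat \<Rightarrow> nat \<Rightarrow> (nat + nat) set" where
  "points k l \<equiv> {1..k} <+> {1..l}"

lemma finite_partitions: "finite (partitions k l)"
  unfolding partitions_def by (intro finitely_many_partition_on) auto

definition same_kernel :: "'a set \<Rightarrow> ('a \<Rightarrow> 'b) \<Rightarrow> ('a \<Rightarrow> 'c) \<Rightarrow> bool" where
  "same_kernel X i j \<longleftrightarrow> (\<forall>x\<in>X. \<forall>y\<in>X. i x = i y \<longleftrightarrow> j x = j y)"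

lemma compatible_same_kernel:
  assumes "p \<in> partitions k l" "same_kernel (points k l) i j"
  shows "compatible i p \<longleftrightarrow> compatible j p"
proof -
  have "B \<subseteq> points k l" if "B \<in> p" for B
    using assms(1) that by (auto simp: partitions_def partition_on_def)
  then show ?thesis
    using assms(2) unfolding compatible_def same_kernel_def by (meson subsetD)
qed

lemma ev_same_kernel:
  assumes "f \<in> Part k l" "same_kernel (points k l) i j"
  shows "ev f i = ev f j"
  unfolding ev_def using assms compatible_same_kernel[OF _ assms(2)]
  by (intro sum.cong) (auto simp: Part_def)

text \<open>The equivalence relation belonging to a partition. Its cardinality grows strictly under
  proper coarsening and so provides the rank function for the triangular systems.\<close>

definition block_rel :: "'a set set \<Rightarrow> ('a \<times> 'a) set" where
  "block_rel p = {(x, y). \<exists>B\<in>p. x \<in> B \<and> y \<in> B}"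

lemma block_rel_inject:
  assumes "partition_on X p" "partition_on X q" "block_rel p = block_rel q"
  shows "p = q"
  using partition_on_eq_quotient[OF assms(1), folded block_rel_def]
    partition_on_eq_quotient[OF assms(2), folded block_rel_def] assms(3) by metis

text \<open>The finitely many blocks can be numbered injectively; each point is coloured by the
  number of its block.\<close>

lemma colouring_of_partition:
  assumes "finite X" "partition_on X p"
  shows "\<exists>i::'a \<Rightarrow> nat. \<forall>x\<in>X. \<forall>y\<in>X. i x = i y \<longleftrightarrow> (x, y) \<in> block_rel p"
proof -
  have eq: "equiv X (block_rel p)"
    using equiv_partition_on[OF assms(2)] by (simp add: block_rel_def)
  obtain c :: "'a set \<Rightarrow> nat" where c: "inj_on c (X // block_rel p)"
    using finite_imp_inj_to_nat_seg[OF finite_elements[OF assms]] partition_on_eq_quotient[OF assms(2)]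
    unfolding block_rel_def by force
  show ?thesis
    by (rule exI[of _ "\<lambda>x. c (block_rel p `` {x})"])
      (simp add: inj_on_eq_iff[OF c quotientI quotientI] eq_equiv_class_iff[OF eq])
qed

lemma partition_of_colouring:
  fixes i :: "'a \<Rightarrow> 'b"
  shows "\<exists>p. partition_on X p \<and> (\<forall>x\<in>X. \<forall>y\<in>X. i x = i y \<longleftrightarrow> (x, y) \<in> block_rel p)"
proof -
  have "partition_on X ((\<lambda>c. X \<inter> i -` {c}) ` i ` X)"
    by (rule partition_onI) (auto simp: disjnt_def)
  moreover have "i x = i y \<longleftrightarrow> (x, y) \<in> block_rel ((\<lambda>c. X \<inter> i -` {c}) ` i ` X)"
    if "x \<in> X" "y \<in> X" for x y
    using that by (auto simp: block_rel_def)
  ultimately show ?thesis by blast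
qed

text \<open>The data that Moebius inversion needs. The colouring \<open>c p\<close> has kernel
  exactly \<open>p\<close>, so \<open>compatible (c q) p\<close> says that \<open>p\<close> refines
  \<open>q\<close>; the resulting matrix is unitriangular with respect to the size of the block
  relation. Every colouring has the kernel of some \<open>c p\<close>, so testing on these
  colourings suffices.\<close>

lemma kernel_system:
  "\<exists>c :: two_row \<Rightarrow> nat + nat \<Rightarrow> nat.
    (\<forall>i :: nat + nat \<Rightarrow> nat. \<exists>p\<in>partitions k l. same_kernel (points k l) i (c p)) \<and>
    (\<forall>p\<in>partitions k l. compatible (c p) p) \<and>
    (\<forall>p\<in>partitions k l. \<forall>q\<in>partitions k l. compatible (c q) p \<longrightarrow> p \<noteq> q
       \<longrightarrow> card (block_rel p) < card (block_rel q))"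
proof -
  let ?X = "points k l"
  have "\<forall>p\<in>partitions k l. \<exists>i::nat + nat \<Rightarrow> nat. \<forall>x\<in>?X. \<forall>y\<in>?X. i x = i y \<longleftrightarrow> (x, y) \<in> block_rel p"
    using colouring_of_partition[of ?X] by (simp add: partitions_def)
  then obtain c :: "two_row \<Rightarrow> nat + nat \<Rightarrow> nat" where
    c: "\<And>p x y. p \<in> partitions k l \<Longrightarrow> x \<in> ?X \<Longrightarrow> y \<in> ?X \<Longrightarrow> c p x = c p y \<longleftrightarrow> (x, y) \<in> block_rel p"
    by metis
  have sub: "block_rel p \<subseteq> ?X \<times> ?X" if "p \<in> partitions k l" for p
    using that by (auto simp: partitions_def partition_on_def block_rel_def)
  have comp: "compatible (c q) p \<longleftrightarrow> block_rel p \<subseteq> block_rel q"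
    if "p \<in> partitions k l" "q \<in> partitions k l" for p q
  proof -
    have "compatible (c q) p \<longleftrightarrow> (\<forall>(x, y)\<in>block_rel p. c q x = c q y)"
      by (auto simp: compatible_def block_rel_def)
    also have "\<dots> \<longleftrightarrow> (\<forall>z\<in>block_rel p. z \<in> block_rel q)"
      using sub[OF that(1)] c[OF that(2)] by (intro ball_cong) auto
    finally show ?thesis by blast
  qed
  have 1: "\<exists>p\<in>partitions k l. same_kernel ?X i (c p)" for i :: "nat + nat \<Rightarrow> nat"
  proof -
    obtain p where "partition_on ?X p" "\<forall>x\<in>?X. \<forall>y\<in>?X. i x = i y \<longleftrightarrow> (x, y) \<in> block_rel p"
      using partition_of_colouring[of ?X i] by blast
    then show ?thesis
      using c[of p] unfolding same_kernel_def partitions_def by (intro bexI[of _ p]) auto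
  qed
  have 2: "card (block_rel p) < card (block_rel q)"
    if *: "p \<in> partitions k l" "q \<in> partitions k l" "compatible (c q) p" "p \<noteq> q" for p q
  proof -
    have "block_rel p \<subset> block_rel q"
      using * comp[of p q] block_rel_inject[of ?X p q] by (auto simp: partitions_def)
    moreover have "finite (block_rel q)"
      using sub[OF *(2)] by (rule finite_subset) auto
    ultimately show ?thesis
      by (simp add: psubset_card_mono)
  qed
  show ?thesis
    using 1 2 comp by (intro exI[of _ c] conjI ballI allI impI) auto
qed

text \<open>A function that only sees kernels is determined by its values at the representatives
  \<open>c q\<close>, and prescribing those values is a solvable triangular system for the
  coefficients.\<close>

lemma ev_surj:
  assumes "\<And>i j. same_kernel (points k l) i j \<Longrightarrow> F i = F j"
  shows "\<exists>f\<in>Part k l. \<forall>i. ev f i = F i"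
proof -
  obtain c :: "two_row \<Rightarrow> nat + nat \<Rightarrow> nat" where
    c: "(\<forall>i :: nat + nat \<Rightarrow> nat. \<exists>p\<in>partitions k l. same_kernel (points k l) i (c p)) \<and>
      (\<forall>p\<in>partitions k l. compatible (c p) p) \<and>
      (\<forall>p\<in>partitions k l. \<forall>q\<in>partitions k l. compatible (c q) p \<longrightarrow> p \<noteq> q
         \<longrightarrow> card (block_rel p) < card (block_rel q))"
    using kernel_system[of k l] by (rule exE)
  have refl: "compatible (c p) p" if "p \<in> partitions k l" for p
    using c that by simp
  have less: "card (block_rel p) < card (block_rel q)"
    if "p \<in> partitions k l" "q \<in> partitions k l" "compatible (c q) p" "p \<noteq> q" for p q
    using c that by simp
  obtain f where f: "\<And>q. q \<in> partitions k l \<Longrightarrow>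
      (\<Sum>p\<in>partitions k l. f p * of_bool (compatible (c q) p)) = F (c q)"
    using triangular_solvable[where P = "partitions k l" and R = "\<lambda>p q. compatible (c q) p"
        and h = "\<lambda>p. card (block_rel p)" and G = "\<lambda>q. F (c q)", OF finite_partitions refl less]
    by blast
  define g where "g = (\<Sum>p\<in>partitions k l. scale (f p) (basis p))"
  have g: "g \<in> Part k l"
    unfolding g_def Part_eq_supported
    by (intro lincomb.subspace_sum subspace_supported scale_basis_in_supported)
  have "ev g i = F i" for i
  proof -
    obtain q where q: "q \<in> partitions k l" "same_kernel (points k l) i (c q)"
      using c by blast
    have "ev g i = ev g (c q)"
      using ev_same_kernel[OF g q(2)] .
    also have "\<dots> = F (c q)"
      using f[OF q(1)] by (simp add: g_def ev_sum ev_scale ev_basis)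
    finally show ?thesis
      using assms[OF q(2)] by simp
  qed
  with g show ?thesis by blast
qed

lemma ev_eq_0:
  assumes "f \<in> Part k l" "\<And>i. ev f i = 0"
  shows "f = 0"
proof -
  obtain c :: "two_row \<Rightarrow> nat + nat \<Rightarrow> nat" where
    c: "(\<forall>i :: nat + nat \<Rightarrow> nat. \<exists>p\<in>partitions k l. same_kernel (points k l) i (c p)) \<and>
      (\<forall>p\<in>partitions k l. compatible (c p) p) \<and>
      (\<forall>p\<in>partitions k l. \<forall>q\<in>partitions k l. compatible (c q) p \<longrightarrow> p \<noteq> q
         \<longrightarrow> card (block_rel p) < card (block_rel q))"
    using kernel_system[of k l] by (rule exE)
  have refl: "compatible (c p) p" if "p \<in> partitions k l" for p
    using c that by simp
  have less: "card (block_rel p) < card (block_rel q)"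
    if "p \<in> partitions k l" "q \<in> partitions k l" "compatible (c q) p" "p \<noteq> q" for p q
    using c that by simp
  have "(\<Sum>p\<in>partitions k l. Poly_Mapping.lookup f p * of_bool (compatible (c q) p)) = 0" for q
    using ev_superset[OF finite_partitions, of f k l "c q"] assms by (simp add: Part_def)
  then have "Poly_Mapping.lookup f p = 0" if "p \<in> partitions k l" for p
    using triangular_unique[where P = "partitions k l" and R = "\<lambda>p q. compatible (c q) p"
        and h = "\<lambda>p. card (block_rel p)" and f = "Poly_Mapping.lookup f", OF finite_partitions refl less] that
    by blast
  then show ?thesis
    using assms(1) by (intro poly_mapping_eqI) (auto simp: Part_def in_keys_iff)
qed

text \<open>Allows identities in \<open>Part\<close> to be checked on colourings; the algebraic
  properties of \<open>twist\<close> are obtained in this way.\<close>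

lemma ev_inject:
  assumes "f \<in> Part k l" "g \<in> Part k l" "\<And>i. ev f i = ev g i"
  shows "f = g"
proof -
  have "f - g \<in> Part k l"
    using assms(1,2) lincomb.subspace_diff[OF subspace_supported] by (simp add: Part_eq_supported)
  then show ?thesis
    using ev_eq_0[of "f - g" k l] assms(3) by (simp add: ev_diff)
qed


section \<open>Compatible colourings and the operations on partitions\<close>

lemma partition_on_Un:
  assumes "partition_on A P" "partition_on B Q" "A \<inter> B = {}"
  shows "partition_on (A \<union> B) (P \<union> Q)"
proof (rule partition_onI)
  show "disjnt p q" if "p \<in> P \<union> Q" "q \<in> P \<union> Q" "p \<noteq> q" for p q
  proof -
    have "p \<inter> q = {}" if "p \<in> P" "q \<in> Q" for p q
      using that assms unfolding partition_on_def by blast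
    then show ?thesis
      using that assms(1,2) unfolding partition_on_def pairwise_def disjnt_def by (metis Un_iff inf_commute)
  qed
qed (use assms in \<open>auto simp: partition_on_def\<close>)

lemma partition_on_image:
  assumes "inj f" "partition_on A P"
  shows "partition_on (f ` A) ((`) f ` P)"
  using assms inj_on_subset[OF assms(1)] by (auto simp: partition_on_def intro!: disjoint_image)

lemma map_sum_image_Plus: "map_sum f g ` (A <+> B) = f ` A <+> g ` B"
  by (auto simp: Plus_def image_Un image_image)

lemma tensor_partition_in_partitions:
  assumes "p \<in> partitions k l" "q \<in> partitions k' l'"
  shows "tensor_partition k l p q \<in> partitions (k + k') (l + l')"
proof -
  let ?s = "map_sum ((+) k) ((+) l)"
  have img: "?s ` points k' l' = {k + 1..k + k'} <+> {l + 1..l + l'}"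
    by (simp add: map_sum_image_Plus add.commute)
  have "points (k + k') (l + l') = points k l \<union> ?s ` points k' l'"
    unfolding img by auto
  moreover have "points k l \<inter> ?s ` points k' l' = {}"
    unfolding img by auto
  moreover have "partition_on (?s ` points k' l') ((`) ?s ` q)"
    using assms(2) by (intro partition_on_image) (auto simp: partitions_def intro!: sum.inj_map)
  ultimately show ?thesis
    using assms(1) by (simp add: partitions_def tensor_partition_def partition_on_Un)
qed

lemma compatible_tensor_partition:
  "compatible i (tensor_partition k l p q) \<longleftrightarrow>
     compatible i p \<and> compatible (i \<circ> map_sum ((+) k) ((+) l)) q"
  by (simp add: compatible_def tensor_partition_def ball_Un)

definition swap_rows :: "nat + nat \<Rightarrow> nat + nat" where
  "swap_rows = case_sum Inr Inl"

lemma swap_rows_simps [simp]: "swap_rows (Inl x) = Inr x" "swap_rows (Inr x) = Inl x"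
  by (simp_all add: swap_rows_def)

lemma inj_swap_rows: "inj swap_rows"
  by (auto simp: inj_def swap_rows_def split: sum.splits)

lemma swap_rows_points: "swap_rows ` points k l = points l k"
  by (auto simp: Plus_def image_Un image_comp)

lemma invol_partition_in_partitions:
  "p \<in> partitions k l \<Longrightarrow> invol_partition p \<in> partitions l k"
  using partition_on_image[OF inj_swap_rows, of "points k l" p]
  by (simp only: partitions_def invol_partition_def swap_rows_points mem_Collect_eq flip: swap_rows_def)

lemma compatible_invol_partition:
  "compatible i (invol_partition p) \<longleftrightarrow> compatible (i \<circ> swap_rows) p"
  by (auto simp: compatible_def invol_partition_def swap_rows_def)

section \<open>Connected components of a family of sets\<close>

definition merge :: "'a set set \<Rightarrow> 'a set set" where
  "merge S = \<Union>S // (\<Union>B\<in>S. B \<times> B)\<^sup>+"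

lemma equiv_merge: "equiv (\<Union>S) ((\<Union>B\<in>S. B \<times> B)\<^sup>+)"
proof (rule equivI)
  show "(\<Union>B\<in>S. B \<times> B)\<^sup>+ \<subseteq> \<Union>S \<times> \<Union>S"
    by (rule trancl_subset_Sigma) auto
  show "refl_on (\<Union>S) ((\<Union>B\<in>S. B \<times> B)\<^sup>+)"
    by (auto simp: refl_on_def)
  show "sym ((\<Union>B\<in>S. B \<times> B)\<^sup>+)"
    by (rule sym_trancl) (auto simp: sym_def)
qed (rule trans_trancl)

lemma partition_on_merge: "partition_on (\<Union>S) (merge S)"
  unfolding merge_def by (rule partition_on_quotient[OF equiv_merge])

text \<open>A colouring constant on each member of \<open>S\<close> is constant along chains of
  overlapping members, and conversely each member lies inside one component. This splits
  compatibility with the components of a stacked diagram into conditions on the two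
  partitions.\<close>

lemma compatible_merge: "compatible e (merge S) \<longleftrightarrow> compatible e S"
proof
  assume e: "compatible e (merge S)"
  show "compatible e S"
    unfolding compatible_def
  proof (intro ballI)
    fix B x y assume "B \<in> S" "x \<in> B" "y \<in> B"
    then have "x \<in> \<Union>S" "(x, x) \<in> (\<Union>B\<in>S. B \<times> B)\<^sup>+" "(x, y) \<in> (\<Union>B\<in>S. B \<times> B)\<^sup>+"
      by auto
    then have "(\<Union>B\<in>S. B \<times> B)\<^sup>+ `` {x} \<in> merge S"
      and "x \<in> (\<Union>B\<in>S. B \<times> B)\<^sup>+ `` {x}" "y \<in> (\<Union>B\<in>S. B \<times> B)\<^sup>+ `` {x}"
      unfolding merge_def by (intro quotientI, blast+)
    then show "e x = e y"
      using e unfolding compatible_def by blast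
  qed
next
  assume e: "compatible e S"
  have *: "e x = e y" if "(x, y) \<in> (\<Union>B\<in>S. B \<times> B)\<^sup>+" for x y
    using that
  proof (induction rule: trancl_induct)
    case (base y)
    then show ?case using e unfolding compatible_def by blast
  next
    case (step y z)
    then have "e y = e z" using e unfolding compatible_def by blast
    then show ?case using step by simp
  qed
  show "compatible e (merge S)"
    unfolding compatible_def merge_def
  proof (intro ballI)
    fix C x y assume "C \<in> \<Union>S // (\<Union>B\<in>S. B \<times> B)\<^sup>+" "x \<in> C" "y \<in> C"
    then show "e x = e y"
      by (intro * in_quotient_imp_in_rel[OF equiv_merge]) auto
  qed
qed

lemma merge_absorb:
  assumes "C \<in> merge S" "B \<in> S" "B \<inter> C \<noteq> {}"
  shows "B \<subseteq> C"
proof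
  fix y assume "y \<in> B"
  obtain x where x: "x \<in> B" "x \<in> C" using assms(3) by blast
  have "(x, y) \<in> (\<Union>B\<in>S. B \<times> B)\<^sup>+"
    using x(1) \<open>y \<in> B\<close> assms(2) by auto
  then show "y \<in> C"
    using in_quotient_imp_closed[OF equiv_merge] assms(1) x(2) unfolding merge_def by metis
qed

text \<open>A chain of members of \<open>S\<close> starting at \<open>x\<close> can never leave the
  saturated set \<open>D\<close>. Together with \<open>merge_absorb\<close> this says that
  components are the minimal nonempty saturated subsets of the union.\<close>

lemma merge_minimal:
  assumes "C \<in> merge S" "x \<in> C" "x \<in> D" "\<And>B. B \<in> S \<Longrightarrow> B \<inter> D \<noteq> {} \<Longrightarrow> B \<subseteq> D"
  shows "C \<subseteq> D"
proof
  fix y assume "y \<in> C"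
  then have "(x, y) \<in> (\<Union>B\<in>S. B \<times> B)\<^sup>+"
    using in_quotient_imp_in_rel[OF equiv_merge, of C S x y] assms(1,2) by (simp add: merge_def)
  then show "y \<in> D"
  proof (induction rule: trancl_induct)
    case (base y)
    then show ?case using assms(3,4) by blast
  next
    case (step y z)
    then show ?case using assms(4) by blast
  qed
qed

text \<open>A connected graph has at most one vertex more than it has edges.\<close>

lemma card_merge_block_le:
  assumes "finite (\<Union>S)" "\<And>B. B \<in> S \<Longrightarrow> card B \<le> 2" "C \<in> merge S"
  shows "card C \<le> card {B \<in> S. B \<subseteq> C} + 1"
proof -
  have "C \<subseteq> \<Union>S"
    using partition_on_merge[of S] assms(3) unfolding partition_on_def by blast
  then have fin: "finite C"
    using assms(1) finite_subset by blast
  have finS: "finite S"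
    using assms(1) finite_UnionD by blast
  obtain x where x: "x \<in> C"
    using partition_on_merge[of S] assms(3) unfolding partition_on_def by (metis ex_in_conv)
  \<comment> \<open>The component is grown from \<open>x\<close>, edge by edge. If an edge
    \<open>B\<close> met a maximal \<open>D\<close> without lying inside it, adding \<open>B\<close>
    would bring at most one new point and at least one new edge, so the bound would persist, against
    maximality. Hence \<open>D\<close> is saturated and is all of \<open>C\<close>.\<close>
  define \<D> where "\<D> = {D. D \<subseteq> C \<and> x \<in> D \<and> card D \<le> card {B \<in> S. B \<subseteq> D} + 1}"
  have "{x} \<in> \<D>" using x by (simp add: \<D>_def)
  moreover have "finite \<D>"
    by (rule finite_subset[of _ "Pow C"]) (use fin in \<open>auto simp: \<D>_def\<close>)
  ultimately obtain D where D: "D \<in> \<D>" "\<And>D'. D' \<in> \<D> \<Longrightarrow> D \<subseteq> D' \<Longrightarrow> D = D'"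
    using finite_has_maximal[of \<D>] by blast
  have DC: "D \<subseteq> C" "x \<in> D" "finite D" and cardD: "card D \<le> card {B \<in> S. B \<subseteq> D} + 1"
    using D(1) fin finite_subset by (auto simp: \<D>_def)
  have "B \<subseteq> D" if B: "B \<in> S" "B \<inter> D \<noteq> {}" for B
  proof (rule ccontr)
    assume nB: "\<not> B \<subseteq> D"
    have finB: "finite B" using B(1) assms(1) by (meson Union_upper finite_subset)
    have "card (D \<union> B) = card D + card (B - D)"
      using DC(3) finB by (metis Diff_disjoint Un_Diff_cancel card_Un_disjoint finite_Diff)
    moreover have "card (B - D) < card B"
      using B(2) finB by (intro psubset_card_mono) auto
    ultimately have "card (D \<union> B) \<le> card D + 1"
      using assms(2)[OF B(1)] by linarith
    moreover have "card {B \<in> S. B \<subseteq> D} < card {B' \<in> S. B' \<subseteq> D \<union> B}"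
      using B(1) nB finS by (intro psubset_card_mono) auto
    ultimately have "D \<union> B \<in> \<D>"
      using cardD DC merge_absorb[OF assms(3) B(1)] B(2) by (auto simp: \<D>_def)
    then show False using D(2)[of "D \<union> B"] nB by blast
  qed
  then have "C \<subseteq> D"
    by (rule merge_minimal[OF assms(3) x DC(2)])
  then show ?thesis
    using DC(1) cardD by (metis subset_antisym)
qed

section \<open>Stacked diagrams and the counting of middle rows\<close>

lemma components_eq_merge: "components q p = merge (stack q p)"
  by (simp add: components_def merge_def)

definition middle :: "nat \<Rightarrow> (nat + (nat + nat)) set" where
  "middle l = Inr ` Inl ` {1..l}"

lemma finite_middle [simp]: "finite (middle l)"
  by (simp add: middle_def)

lemma Union_stack:
  assumes "p \<in> partitions k l" "q \<in> partitions l m"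
  shows "\<Union>(stack q p) = {1..k} <+> ({1..l} <+> {1..m})"
proof -
  have "\<Union>(stack q p) = map_sum id Inl ` \<Union>p \<union> Inr ` \<Union>q"
    by (auto simp: stack_def)
  also have "\<dots> = map_sum id Inl ` points k l \<union> Inr ` points l m"
    using assms by (simp add: partitions_def partition_on_def)
  also have "\<dots> = {1..k} <+> ({1..l} <+> {1..m})"
    by (auto simp: Plus_def image_Un image_comp)
  finally show ?thesis .
qed

lemma partition_on_components:
  assumes "p \<in> partitions k l" "q \<in> partitions l m"
  shows "partition_on ({1..k} <+> ({1..l} <+> {1..m})) (components q p)"
  using partition_on_merge[of "stack q p"] by (simp add: components_eq_merge Union_stack[OF assms])

text \<open>The composed partition is the restriction of the components to the outer rows; the
  components of middle points alone leave an empty trace, which is discarded.\<close>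

lemma comp_partition_in_partitions:
  assumes "p \<in> partitions k l" "q \<in> partitions l m"
  shows "comp_partition q p \<in> partitions k m"
proof -
  have "map_sum id Inr -` ({1..k} <+> ({1..l} <+> {1..m})) = points k m"
  proof (intro set_eqI)
    fix x :: "nat + nat"
    show "x \<in> map_sum id Inr -` ({1..k} <+> ({1..l} <+> {1..m})) \<longleftrightarrow> x \<in> points k m"
      by (cases x) auto
  qed
  then show ?thesis
    using partition_on_vimage[OF partition_on_components[OF assms], of "map_sum id Inr"]
    by (simp add: partitions_def comp_partition_def)
qed

text \<open>A compatible extension chooses one colour freely for each block inside \<open>M\<close>.
  On a block that leaves \<open>M\<close> the colour is forced by \<open>e\<close>, provided that
  \<open>e\<close> is constant on its outer points. The bound on \<open>e\<close> keeps the forced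
  colours in range.\<close>

lemma card_compatible_extensions:
  fixes e :: "'a \<Rightarrow> nat"
  assumes "finite Z" "partition_on Z W" "M \<subseteq> Z" "\<And>x. x \<in> Z - M \<Longrightarrow> e x < N"
  shows "card {b \<in> M \<rightarrow>\<^sub>E {..<N}. compatible (\<lambda>x. if x \<in> M then b x else e x) W}
    = (if \<forall>C\<in>W. \<forall>x\<in>C - M. \<forall>y\<in>C - M. e x = e y then N ^ card {C \<in> W. C \<subseteq> M} else 0)"
    (is "card ?A = _")
proof (cases "\<forall>C\<in>W. \<forall>x\<in>C - M. \<forall>y\<in>C - M. e x = e y")
  case False
  then have "?A = {}" unfolding compatible_def by fastforce
  with False show ?thesis by (simp only: card.empty if_False)
next
  case True
  let ?L = "{C \<in> W. C \<subseteq> M}"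
  have finW: "finite W" using finite_elements[OF assms(1,2)] .
  have "\<forall>x\<in>Z. \<exists>C. C \<in> W \<and> x \<in> C"
    using assms(2) unfolding partition_on_def by blast
  then obtain cl where "\<forall>x\<in>Z. cl x \<in> W \<and> x \<in> cl x"
    by (rule bchoice[THEN exE])
  then have cl: "cl x \<in> W \<and> x \<in> cl x" if "x \<in> Z" for x
    using that by simp
  have cl_eq: "cl x = C" if "C \<in> W" "x \<in> C" for C x
    using that cl[of x] assms(2) unfolding partition_on_def disjoint_def by blast
  have nonempty: "C \<noteq> {}" if "C \<in> W" for C
    using that assms(2) by (auto simp: partition_on_def)
  \<comment> \<open>\<open>F\<close> turns a free choice \<open>g\<close> of block colours into an
    extension. Which outer point is selected is irrelevant, because \<open>e\<close> is constant on
    the outer points of each block.\<close>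
  define F where "F g = (\<lambda>x\<in>M. if cl x \<subseteq> M then g (cl x) else e (SOME y. y \<in> cl x - M))"
    for g :: "'a set \<Rightarrow> nat"
  have pt: "(SOME y. y \<in> C - M) \<in> C - M" if "\<not> C \<subseteq> M" for C
    using that by (intro someI_ex[of "\<lambda>y. y \<in> C - M"]) blast
  have F_out: "F g x = e y" if "C \<in> W" "x \<in> C" "x \<in> M" "y \<in> C - M" for g C x y
  proof -
    have "\<not> C \<subseteq> M" using that by blast
    then have "F g x = e (SOME y. y \<in> C - M)" "(SOME y. y \<in> C - M) \<in> C - M"
      using that(3) pt[of C] by (simp_all add: F_def cl_eq[OF that(1,2)])
    then show ?thesis
      using True that(1,4) by metis
  qed
  have "bij_betw F (?L \<rightarrow>\<^sub>E {..<N}) ?A"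
    unfolding bij_betw_def
  proof (intro conjI inj_onI subset_antisym subsetI)
    fix g g' assume g: "g \<in> ?L \<rightarrow>\<^sub>E {..<N}" "g' \<in> ?L \<rightarrow>\<^sub>E {..<N}" "F g = F g'"
    show "g = g'"
    proof (rule PiE_ext[OF g(1,2)])
      fix C assume C: "C \<in> ?L"
      then obtain x where x: "x \<in> C" using nonempty by blast
      have "F g x = F g' x" using g(3) by simp
      then show "g C = g' C"
        using C x cl_eq[of C x] by (auto simp: F_def split: if_splits)
    qed
  next
    fix b assume "b \<in> F ` (?L \<rightarrow>\<^sub>E {..<N})"
    then obtain g where g: "g \<in> ?L \<rightarrow>\<^sub>E {..<N}" "b = F g" by blast
    have "b x < N" if "x \<in> M" for x
    proof (cases "cl x \<subseteq> M")
      case True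
      then show ?thesis
        using g cl[of x] that assms(3) by (auto simp: F_def PiE_iff)
    next
      case False
      have "cl x \<subseteq> Z" using cl[of x] that assms(2,3) by (auto simp: partition_on_def)
      then show ?thesis
        using False pt[OF False] assms(4) that g(2) by (auto simp: F_def)
    qed
    then have "b \<in> M \<rightarrow>\<^sub>E {..<N}"
      using g(2) by (auto simp: F_def)
    moreover have "(if x \<in> M then b x else e x) = (if y \<in> M then b y else e y)"
      if C: "C \<in> W" "x \<in> C" "y \<in> C" for C x y
    proof (cases "x \<in> M \<and> y \<in> M")
      case in_M: True
      then show ?thesis
        using cl_eq[OF C(1,2)] cl_eq[OF C(1,3)] g(2) by (simp add: F_def)
    next
      case False
      then consider "x \<in> M" "y \<in> C - M" | "y \<in> M" "x \<in> C - M" | "x \<in> C - M" "y \<in> C - M"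
        using C by blast
      then show ?thesis
      proof cases
        case 1
        then show ?thesis using F_out[OF C(1,2), of y] g(2) by simp
      next
        case 2
        then show ?thesis using F_out[OF C(1,3), of x] g(2) by simp
      next
        case 3
        moreover have "e x = e y" using True C(1) 3 by blast
        ultimately show ?thesis by simp
      qed
    qed
    ultimately show "b \<in> ?A" unfolding compatible_def by blast
  next
    fix b assume "b \<in> ?A"
    then have b: "b \<in> M \<rightarrow>\<^sub>E {..<N}"
      and comp: "\<And>C x y. C \<in> W \<Longrightarrow> x \<in> C \<Longrightarrow> y \<in> C \<Longrightarrow>
        (if x \<in> M then b x else e x) = (if y \<in> M then b y else e y)"
      unfolding compatible_def by blast+
    \<comment> \<open>The preimage of \<open>b\<close> under \<open>F\<close> reads off the colour
      at an arbitrary point of each block inside \<open>M\<close>.\<close>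
    define g where "g = (\<lambda>C\<in>?L. b (SOME x. x \<in> C))"
    have some_in: "(SOME x. x \<in> C) \<in> C" if "C \<in> W" for C
      using nonempty[OF that] by (simp add: some_in_eq)
    have "g \<in> ?L \<rightarrow>\<^sub>E {..<N}"
      unfolding g_def restrict_PiE_iff by (intro ballI PiE_mem[OF b]) (use some_in in blast)
    moreover have "b x = F g x" for x
    proof (cases "x \<in> M")
      case xM: True
      then have x: "cl x \<in> W" "x \<in> cl x" using cl assms(3) by auto
      show ?thesis
      proof (cases "cl x \<subseteq> M")
        case True
        then show ?thesis
          using x xM some_in[OF x(1)] comp[OF x(1) x(2) some_in[OF x(1)]] by (auto simp: F_def g_def)
      next
        case False
        then show ?thesis
          using xM comp[OF x(1) x(2), of "SOME y. y \<in> cl x - M"] pt[OF False] by (auto simp: F_def)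
      qed
    qed (use PiE_arb[OF b] in \<open>simp add: F_def\<close>)
    ultimately show "b \<in> F ` (?L \<rightarrow>\<^sub>E {..<N})" by (intro image_eqI ext)
  qed
  then have "card ?A = card (?L \<rightarrow>\<^sub>E {..<N})" by (simp add: bij_betw_same_card)
  also have "\<dots> = N ^ card ?L" using finW by (simp add: card_PiE)
  finally show ?thesis unfolding if_P[OF True] .
qed

text \<open>The colouring of three rows with outer rows \<open>i\<close> and middle row \<open>b\<close>.\<close>

definition glue :: "nat \<Rightarrow> (nat + nat \<Rightarrow> nat) \<Rightarrow> (nat + (nat + nat) \<Rightarrow> nat) \<Rightarrow> nat + (nat + nat) \<Rightarrow> nat" where
  "glue l i b = (\<lambda>x. if x \<in> middle l then b x else case_sum (i \<circ> Inl) (case_sum (\<lambda>_. 0) (i \<circ> Inr)) x)"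

lemma compatible_stack:
  "compatible e (stack q p) \<longleftrightarrow> compatible (e \<circ> map_sum id Inl) p \<and> compatible (e \<circ> Inr) q"
  by (simp add: compatible_def stack_def ball_Un)

text \<open>Each loop contributes one free colour, hence a factor \<open>N\<close>, while every
  other component forces its outer points to share a colour. This is what makes composition with
  parameter \<open>N\<close> a matrix product.\<close>

lemma card_compatible_glue:
  assumes p: "p \<in> partitions k l" and q: "q \<in> partitions l m"
    and i: "\<And>x. x \<in> points k m \<Longrightarrow> i x < N"
  shows "card {b \<in> middle l \<rightarrow>\<^sub>E {..<N}. compatible (glue l i b \<circ> map_sum id Inl) p
      \<and> compatible (glue l i b \<circ> Inr) q}
    = N ^ loops q p * of_bool (compatible i (comp_partition q p))"
proof -
  let ?Z = "{1..k} <+> ({1..l} <+> {1..m})" and ?W = "components q p"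
  let ?e = "case_sum (i \<circ> Inl) (case_sum (\<lambda>_. 0) (i \<circ> Inr))"
  have part: "partition_on ?Z ?W"
    using partition_on_components[OF p q] .
  have outer: "?Z - middle l = map_sum id Inr ` points k m"
    by (auto simp: middle_def Plus_def image_Un image_comp)
  have e: "?e (map_sum id Inr x) = i x" for x
    by (cases x) auto
  have sub: "C \<subseteq> ?Z" if "C \<in> ?W" for C
    using part that by (auto simp: partition_on_def)
  have loop: "C \<subseteq> middle l \<longleftrightarrow> C \<subseteq> range (Inr \<circ> Inl)" if "C \<in> ?W" for C
    using sub[OF that] by (auto simp: middle_def)
  have "(\<forall>x\<in>C - middle l. \<forall>y\<in>C - middle l. ?e x = ?e y) \<longleftrightarrow>
      (\<forall>x. map_sum id Inr x \<in> C \<longrightarrow> (\<forall>y. map_sum id Inr y \<in> C \<longrightarrow> i x = i y))" if C: "C \<in> ?W" for C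
  proof -
    have "range (map_sum id Inr) \<inter> middle l = {}"
      by (auto simp: middle_def map_sum_def split: sum.splits)
    moreover have "C - middle l \<subseteq> range (map_sum id Inr)"
      using Diff_mono[OF sub[OF C] order_refl, of "middle l"] unfolding outer by (rule order_trans) auto
    ultimately have "C - middle l = map_sum id Inr ` (map_sum id Inr -` C)"
      unfolding image_vimage_eq by blast
    then show ?thesis
      by (simp add: e del: image_vimage_eq) blast
  qed
  then have "(\<forall>C\<in>?W. \<forall>x\<in>C - middle l. \<forall>y\<in>C - middle l. ?e x = ?e y) \<longleftrightarrow>
      (\<forall>C\<in>?W. \<forall>x. map_sum id Inr x \<in> C \<longrightarrow> (\<forall>y. map_sum id Inr y \<in> C \<longrightarrow> i x = i y))"
    by (rule ball_cong[OF refl])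
  also have "\<dots> \<longleftrightarrow> compatible i (comp_partition q p)"
    unfolding compatible_def comp_partition_def by blast
  finally have comp: "(\<forall>C\<in>?W. \<forall>x\<in>C - middle l. \<forall>y\<in>C - middle l. ?e x = ?e y) \<longleftrightarrow>
      compatible i (comp_partition q p)" .
  \<comment> \<open>Compatibility with both partitions is compatibility with the stacked family, and
    so with its components; this brings the count into the form of
    \<open>card_compatible_extensions\<close>.\<close>
  have "{b \<in> middle l \<rightarrow>\<^sub>E {..<N}. compatible (glue l i b \<circ> map_sum id Inl) p \<and> compatible (glue l i b \<circ> Inr) q}
    = {b \<in> middle l \<rightarrow>\<^sub>E {..<N}. compatible (\<lambda>x. if x \<in> middle l then b x else ?e x) ?W}"
    by (simp add: components_eq_merge compatible_merge compatible_stack glue_def[abs_def])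
  moreover have "middle l \<subseteq> ?Z"
    unfolding middle_def by blast
  moreover have "finite ?Z"
    by (intro finite_Plus) auto
  moreover have "?e x < N" if x: "x \<in> ?Z - middle l" for x
  proof -
    obtain y where y: "x = map_sum id Inr y" "y \<in> points k m"
      using x unfolding outer by (rule imageE)
    show ?thesis using i[OF y(2)] unfolding y(1) e .
  qed
  moreover have "{C \<in> ?W. C \<subseteq> middle l} = {C \<in> ?W. C \<subseteq> range (Inr \<circ> Inl)}"
    using loop by blast
  ultimately show ?thesis
    using card_compatible_extensions[OF _ part, of "middle l" ?e N] unfolding comp loops_def by simp
qed


section \<open>Signs of even colourings\<close>

lemma ev_tensor: "ev (tensor k l f g) i = ev f i * ev g (i \<circ> map_sum ((+) k) ((+) l))"
  unfolding tensor_def ev_sum ev_scale ev_basis compatible_tensor_partition of_bool_conj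
  by (simp only: ev_def sum_product) (simp only: mult_ac)

lemma ev_invol: "ev (invol f) i = cnj (ev f (i \<circ> swap_rows))"
  unfolding invol_def ev_sum ev_scale ev_basis compatible_invol_partition
  by (simp only: ev_def cnj_sum complex_cnj_mult) (intro sum.cong refl, simp)

lemma ev_composition:
  "ev (composition \<delta> g f) i = (\<Sum>p\<in>Poly_Mapping.keys f. \<Sum>q\<in>Poly_Mapping.keys g.
     Poly_Mapping.lookup g q * Poly_Mapping.lookup f p *
       (\<delta> ^ loops q p * of_bool (compatible i (comp_partition q p))))"
  unfolding composition_def ev_sum ev_scale ev_basis ..

text \<open>The number of loops does not depend on \<delta>, so each term is a monomial in \<delta>.
  This permits passing from large natural values of \<delta> to all complex ones.\<close>

lemma ev_composition_poly: "\<exists>P. \<forall>\<delta>. ev (composition \<delta> g f) i = poly P \<delta>"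
  by (rule exI[of _ "\<Sum>p\<in>Poly_Mapping.keys f. \<Sum>q\<in>Poly_Mapping.keys g.
     monom (Poly_Mapping.lookup g q * Poly_Mapping.lookup f p *
       of_bool (compatible i (comp_partition q p))) (loops q p)"])
    (simp only: ev_composition poly_sum poly_monom mult_ac, simp)

text \<open>Replacing each power of \<open>N\<close> by the number of compatible middle rows and
  exchanging the sums gives a matrix product, with the middle row as summation index.\<close>

lemma ev_composition_of_nat:
  assumes f: "f \<in> Part k l" and g: "g \<in> Part l m" and i: "\<And>x. x \<in> points k m \<Longrightarrow> i x < N"
  shows "ev (composition (of_nat N) g f) i = (\<Sum>b\<in>middle l \<rightarrow>\<^sub>E {..<N}.
    ev f (glue l i b \<circ> map_sum id Inl) * ev g (glue l i b \<circ> Inr))"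
proof -
  let ?B = "middle l \<rightarrow>\<^sub>E {..<N}" and ?f = "Poly_Mapping.lookup f" and ?g = "Poly_Mapping.lookup g"
  let ?p = "\<lambda>p b. compatible (glue l i b \<circ> map_sum id Inl) p" and ?q = "\<lambda>q b. compatible (glue l i b \<circ> Inr) q"
  have finB: "finite ?B" by (intro finite_PiE) auto
  have count: "(of_nat N ^ loops q p * of_bool (compatible i (comp_partition q p)) :: complex) =
      (\<Sum>b\<in>?B. of_bool (?p p b) * of_bool (?q q b))"
    if "p \<in> Poly_Mapping.keys f" "q \<in> Poly_Mapping.keys g" for p q
  proof -
    have "p \<in> partitions k l" "q \<in> partitions l m"
      using that f g by (auto simp: Part_def)
    from card_compatible_glue[OF this i]
    have "of_nat N ^ loops q p * of_bool (compatible i (comp_partition q p)) =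
        (of_nat (card {b \<in> ?B. ?p p b \<and> ?q q b}) :: complex)"
      by simp
    also have "\<dots> = (\<Sum>b\<in>{b \<in> ?B. ?p p b \<and> ?q q b}. 1)"
      by simp
    also have "\<dots> = (\<Sum>b\<in>?B. of_bool (?p p b) * of_bool (?q q b))"
      using finB by (intro sum.mono_neutral_cong_left) auto
    finally show ?thesis .
  qed
  have "ev (composition (of_nat N) g f) i = (\<Sum>p\<in>Poly_Mapping.keys f. \<Sum>q\<in>Poly_Mapping.keys g.
      \<Sum>b\<in>?B. ?g q * ?f p * (of_bool (?p p b) * of_bool (?q q b)))"
    unfolding ev_composition sum_distrib_left[symmetric] by (intro sum.cong refl) (simp only: count)
  also have "\<dots> = (\<Sum>p\<in>Poly_Mapping.keys f. \<Sum>b\<in>?B. \<Sum>q\<in>Poly_Mapping.keys g.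
      ?g q * ?f p * (of_bool (?p p b) * of_bool (?q q b)))"
    by (intro sum.cong refl sum.swap)
  also have "\<dots> = (\<Sum>b\<in>?B. \<Sum>p\<in>Poly_Mapping.keys f. \<Sum>q\<in>Poly_Mapping.keys g.
      ?g q * ?f p * (of_bool (?p p b) * of_bool (?q q b)))"
    by (rule sum.swap)
  also have "\<dots> = (\<Sum>b\<in>?B. ev f (glue l i b \<circ> map_sum id Inl) * ev g (glue l i b \<circ> Inr))"
    unfolding ev_def sum_product by (intro sum.cong refl) (simp only: mult_ac)
  finally show ?thesis .
qed

section \<open>Even colourings\<close>

definition even_colouring :: "'a set \<Rightarrow> ('a \<Rightarrow> 'b) \<Rightarrow> bool" where
  "even_colouring X i \<longleftrightarrow> (\<forall>c. even (card {x \<in> X. i x = c}))"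

text \<open>Grouped by colour, the sum has a constant summand on each class, repeated an even number
  of times. The parity arguments for change of colours and for tensor products rest on this.\<close>

lemma even_sum_even_colouring:
  fixes h :: "'a \<Rightarrow> nat"
  assumes "finite X" "even_colouring X i"
    and h: "\<And>x y. x \<in> X \<Longrightarrow> y \<in> X \<Longrightarrow> i x = i y \<Longrightarrow> h x = h y"
  shows "even (\<Sum>x\<in>X. h x)"
proof -
  have "even (\<Sum>x\<in>{x. x \<in> X \<and> i x = c}. h x)" if "c \<in> i ` X" for c
  proof -
    obtain z where z: "z \<in> X" "i z = c" using \<open>c \<in> i ` X\<close> by blast
    have "(\<Sum>x\<in>{x. x \<in> X \<and> i x = c}. h x) = (\<Sum>x\<in>{x. x \<in> X \<and> i x = c}. h z)"
      by (intro sum.cong refl h) (use z in auto)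
    then show ?thesis
      using assms(2) by (simp add: even_colouring_def)
  qed
  then show ?thesis
    unfolding sum.image_gen[OF assms(1), of h i] by (rule dvd_sum)
qed

lemma even_colouring_same_kernel:
  assumes "same_kernel X i j" "even_colouring X i"
  shows "even_colouring X j"
  unfolding even_colouring_def
proof
  fix c
  show "even (card {x \<in> X. j x = c})"
  proof (cases "\<exists>z\<in>X. j z = c")
    case True
    then obtain z where "z \<in> X" "j z = c" by blast
    then have "{x \<in> X. j x = c} = {x \<in> X. i x = i z}"
      using assms(1) by (auto simp: same_kernel_def)
    then show ?thesis using assms(2) by (simp add: even_colouring_def)
  next
    case False
    then have "{x \<in> X. j x = c} = {}" by auto
    then show ?thesis by (simp only: card.empty even_zero)
  qed
qed

lemma same_kernelD: "same_kernel X i j \<Longrightarrow> x \<in> X \<Longrightarrow> y \<in> X \<Longrightarrow> i x = i y \<longleftrightarrow> j x = j y"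
  by (simp add: same_kernel_def)

lemma same_kernel_sym: "same_kernel X i j \<Longrightarrow> same_kernel X j i"
  by (auto simp: same_kernel_def)

lemma card_points_colour:
  "card {x \<in> points k l. i x = c} =
     card {s \<in> {1..k}. i (Inl s) = c} + card {t \<in> {1..l}. i (Inr t) = c}"
proof -
  have "{x \<in> points k l. i x = c} = {s \<in> {1..k}. i (Inl s) = c} <+> {t \<in> {1..l}. i (Inr t) = c}"
    by auto
  then show ?thesis using card_Plus[of "{s \<in> {1..k}. i (Inl s) = c}" "{t \<in> {1..l}. i (Inr t) = c}"]
    by simp
qed

lemma even_colouring_points:
  "even_colouring (points k l) i \<longleftrightarrow>
     (\<forall>c. even (card {s \<in> {1..k}. i (Inl s) = c} + card {t \<in> {1..l}. i (Inr t) = c}))"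
  by (simp only: even_colouring_def card_points_colour)

lemma sum_points: "(\<Sum>x\<in>points k l. h x) = (\<Sum>s=1..k. h (Inl s)) + (\<Sum>t=1..l. h (Inr t))"
  by (simp add: sum.Plus)

section \<open>Parity of inversions\<close>

definition inversions :: "nat \<Rightarrow> (nat \<Rightarrow> nat) \<Rightarrow> nat" where
  "inversions n a = (\<Sum>t=1..n. \<Sum>s=1..<t. of_bool (a t < a s))"

lemma inversions_0 [simp]: "inversions 0 a = 0"
  by (simp add: inversions_def)

lemma inversions_Suc: "inversions (Suc n) a = inversions n a + (\<Sum>s=1..n. of_bool (a (Suc n) < a s))"
  by (simp add: inversions_def atLeastLessThanSuc_atLeastAtMost del: sum_of_bool_eq)

lemma sum_atLeastAtMost_add:
  fixes h :: "nat \<Rightarrow> 'a::comm_monoid_add"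
  shows "(\<Sum>s=1..k + k'. h s) = (\<Sum>s=1..k. h s) + (\<Sum>s=1..k'. h (k + s))"
  by (induction k') (auto simp: add.assoc)

lemma inversions_add:
  "inversions (k + k') a = inversions k a + inversions k' (a \<circ> (+) k)
     + (\<Sum>t=1..k'. \<Sum>s=1..k. of_bool (a (k + t) < a s))"
proof (induction k')
  case (Suc k')
  then show ?case
    using sum_atLeastAtMost_add[of "\<lambda>s. of_bool (a (Suc (k + k')) < a s) :: nat" k k']
    by (simp add: inversions_Suc del: sum_of_bool_eq)
qed simp

text \<open>Every ordered pair of distinct indices occurs exactly once on the left, and the diagonal
  contributes nothing.\<close>

lemma sum_below_diagonal:
  fixes q :: "nat \<Rightarrow> nat \<Rightarrow> nat"
  assumes "\<And>s. q s s = 0"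
  shows "(\<Sum>t=1..n. \<Sum>s=1..<t. q s t + q t s) = (\<Sum>t=1..n. \<Sum>s=1..n. q s t)"
proof (induction n)
  case (Suc n)
  then show ?case
    using assms by (simp add: atLeastLessThanSuc_atLeastAtMost sum.distrib)
qed simp

text \<open>Within one row, the parity change of the inversions is the number of ordered pairs of
  points whose colours \<open>i\<close> and \<open>j\<close> order oppositely. Evenness of the
  colouring relates the upper-upper count, and likewise the lower-lower count, modulo 2 to the same
  mixed count, so the changes of the two rows cancel.\<close>

lemma even_inversions_same_kernel:
  fixes i j :: "nat + nat \<Rightarrow> nat"
  assumes "same_kernel (points k l) i j" "even_colouring (points k l) i"
  shows "even (inversions k (i \<circ> Inl) + inversions l (i \<circ> Inr)) \<longleftrightarrow>
    even (inversions k (j \<circ> Inl) + inversions l (j \<circ> Inr))"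
proof -
  \<comment> \<open>\<open>q\<close> records a reversed pair in one direction only, so that for two
    points of different colours exactly one of \<open>q x y\<close> and \<open>q y x\<close> is 1 if
    their order is reversed.\<close>
  define q :: "nat + nat \<Rightarrow> nat + nat \<Rightarrow> nat" where
    "q x y = of_bool (i x < i y \<and> j y < j x)" for x y
  have row: "even (inversions n (i \<circ> r) + inversions n (j \<circ> r) + (\<Sum>t=1..n. \<Sum>s=1..n. q (r s) (r t)))"
    if r: "r ` {1..n} \<subseteq> points k l" for n and r :: "nat \<Rightarrow> nat + nat"
  proof -
    have "even (of_bool (i (r t) < i (r s)) + of_bool (j (r t) < j (r s)) + (q (r s) (r t) + q (r t) (r s)))"
      if "t \<in> {1..n}" "s \<in> {1..<t}" for s t
    proof -
      have "r s \<in> points k l" "r t \<in> points k l" using that r by auto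
      then have "i (r s) = i (r t) \<longleftrightarrow> j (r s) = j (r t)"
        by (rule same_kernelD[OF assms(1)])
      then show ?thesis
        by (cases "i (r s)" "i (r t)" rule: linorder_cases; cases "j (r s)" "j (r t)" rule: linorder_cases)
          (simp_all add: q_def)
    qed
    then have "even (\<Sum>t=1..n. \<Sum>s=1..<t. of_bool (i (r t) < i (r s)) + of_bool (j (r t) < j (r s))
        + (q (r s) (r t) + q (r t) (r s)))"
      by (intro dvd_sum) blast
    moreover have "(\<Sum>t=1..n. \<Sum>s=1..<t. q (r s) (r t) + q (r t) (r s))
        = (\<Sum>t=1..n. \<Sum>s=1..n. q (r s) (r t))"
      by (rule sum_below_diagonal) (simp add: q_def)
    ultimately show ?thesis
      by (simp only: inversions_def sum.distrib comp_apply)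
  qed
  have col: "even (\<Sum>x\<in>points k l. q x y)" for y
  proof (rule even_sum_even_colouring[OF _ assms(2)])
    fix x x' assume "x \<in> points k l" "x' \<in> points k l" "i x = i x'"
    then show "q x y = q x' y" using same_kernelD[OF assms(1), of x x'] by (simp add: q_def)
  qed simp
  have col': "even (\<Sum>y\<in>points k l. \<Sum>s=1..k. q (Inl s) y)"
  proof (rule even_sum_even_colouring[OF _ assms(2)])
    fix y y' assume "y \<in> points k l" "y' \<in> points k l" "i y = i y'"
    then show "(\<Sum>s=1..k. q (Inl s) y) = (\<Sum>s=1..k. q (Inl s) y')"
      using same_kernelD[OF assms(1), of y y'] by (simp add: q_def)
  qed simp
  \<comment> \<open>Summing the first argument over all points shows that the mixed and lower-lower
    counts have even sum; \<open>col'\<close>, summing the second argument, does the same for the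
    mixed and upper-upper counts.\<close>
  have "even (\<Sum>t=1..l. \<Sum>x\<in>points k l. q x (Inr t))"
    by (intro dvd_sum col)
  then have "even ((\<Sum>t=1..l. \<Sum>s=1..k. q (Inl s) (Inr t)) + (\<Sum>t=1..l. \<Sum>s=1..l. q (Inr s) (Inr t)))"
    by (simp only: sum_points sum.distrib)
  moreover have "even ((\<Sum>t=1..k. \<Sum>s=1..k. q (Inl s) (Inl t)) + (\<Sum>t=1..l. \<Sum>s=1..k. q (Inl s) (Inr t)))"
    using col' by (simp only: sum_points)
  moreover have row_subset: "Inl ` {1..k} \<subseteq> points k l" "Inr ` {1..l} \<subseteq> points k l"
    by auto
  ultimately show ?thesis
    using row[of Inl k, OF row_subset(1)] row[of Inr l, OF row_subset(2)] unfolding even_add by argo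
qed

text \<open>For even \<open>i\<close> this is \<open>(-1)\<^sup>n\<close>, where \<open>n\<close> is the number of crossings of differently
  coloured strings in any pairing with which \<open>i\<close> is compatible.\<close>

definition twist_sign :: "nat \<Rightarrow> nat \<Rightarrow> (nat + nat \<Rightarrow> nat) \<Rightarrow> complex" where
  "twist_sign k l i = (if even_colouring (points k l) i
     then (-1) ^ (inversions k (i \<circ> Inl) + inversions l (i \<circ> Inr)) else 0)"

lemma twist_sign_same_kernel:
  assumes "same_kernel (points k l) i j"
  shows "twist_sign k l i = twist_sign k l j"
proof -
  have "even_colouring (points k l) i \<longleftrightarrow> even_colouring (points k l) j"
    using assms even_colouring_same_kernel same_kernel_sym by blast
  then show ?thesis
    using even_inversions_same_kernel[OF assms] by (simp add: twist_sign_def minus_one_power_iff)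
qed

lemma twist_sign_square: "even_colouring (points k l) i \<Longrightarrow> twist_sign k l i * twist_sign k l i = 1"
  by (simp add: twist_sign_def flip: power_mult_distrib)

lemma cnj_twist_sign [simp]: "cnj (twist_sign k l i) = twist_sign k l i"
  by (simp add: twist_sign_def)

lemma even_colouring_swap_rows:
  "even_colouring (points k l) (i \<circ> swap_rows) \<longleftrightarrow> even_colouring (points l k) i"
  by (simp only: even_colouring_points comp_apply swap_rows_simps add.commute)

lemma twist_sign_swap_rows: "twist_sign k l (i \<circ> swap_rows) = twist_sign l k i"
proof -
  have "(i \<circ> swap_rows) \<circ> Inl = i \<circ> Inr" "(i \<circ> swap_rows) \<circ> Inr = i \<circ> Inl"
    by auto
  then show ?thesis
    unfolding twist_sign_def even_colouring_swap_rows by (simp only: add.commute)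
qed

text \<open>For each colour, the upper and middle counts have equal parity, and so do the middle and
  lower counts.\<close>

lemma even_colouring_compose:
  assumes "even_colouring (points k l) (e \<circ> map_sum id Inl)" "even_colouring (points l m) (e \<circ> Inr)"
  shows "even_colouring (points k m) (e \<circ> map_sum id Inr)"
  using assms unfolding even_colouring_points by (auto simp: comp_def)

lemma twist_sign_compose:
  assumes "even_colouring (points k l) (e \<circ> map_sum id Inl)" "even_colouring (points l m) (e \<circ> Inr)"
  shows "twist_sign k l (e \<circ> map_sum id Inl) * twist_sign l m (e \<circ> Inr)
    = twist_sign k m (e \<circ> map_sum id Inr)"
proof -
  have rows: "(e \<circ> map_sum id Inl) \<circ> Inl = e \<circ> Inl" "(e \<circ> map_sum id Inl) \<circ> Inr = e \<circ> Inr \<circ> Inl"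
    "(e \<circ> map_sum id Inr) \<circ> Inl = e \<circ> Inl" "(e \<circ> map_sum id Inr) \<circ> Inr = e \<circ> Inr \<circ> Inr"
    by auto
  \<comment> \<open>Here \<open>b\<close> stands for the inversions of the middle row, which enter
    both signs.\<close>
  have *: "(-1) ^ (a + b) * (-1) ^ (b + c) = ((-1) ^ (a + c) :: complex)" for a b c :: nat
    by (simp add: minus_one_power_iff)
  show ?thesis
    unfolding twist_sign_def if_P[OF assms(1)] if_P[OF assms(2)]
      if_P[OF even_colouring_compose[OF assms]] rows * ..
qed

text \<open>Beyond the inversions of the two factors there are those between left and right points
  of the upper row, \<open>X\<close>, and of the lower row, \<open>Y\<close>. The auxiliary count
  \<open>Z\<close> compares lower right with upper left points: \<open>Z + Y\<close> is even because
  the left colouring is even, \<open>X + Z\<close> because the right one is, and hence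
  \<open>X + Y\<close> is even.\<close>

lemma
  fixes i :: "nat + nat \<Rightarrow> nat"
  assumes even: "even_colouring (points k l) i"
    "even_colouring (points k' l') (i \<circ> map_sum ((+) k) ((+) l))"
  shows even_colouring_tensor: "even_colouring (points (k + k') (l + l')) i"
    and twist_sign_tensor: "twist_sign (k + k') (l + l') i
      = twist_sign k l i * twist_sign k' l' (i \<circ> map_sum ((+) k) ((+) l))"
proof -
  let ?i' = "i \<circ> map_sum ((+) k) ((+) l)"
  have split: "card {s \<in> {1..n + n'}. a s = c} = card {s \<in> {1..n}. a s = c} + card {s \<in> {1..n'}. a (n + s) = c}"
    for n n' c and a :: "nat \<Rightarrow> nat"
    using sum_atLeastAtMost_add[of "\<lambda>s. of_bool (a s = c) :: nat" n n'] by (simp add: Int_def)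
  show whole: "even_colouring (points (k + k') (l + l')) i"
    using even unfolding even_colouring_points split by auto
  define f where "f c = (\<Sum>s=1..k. of_bool (c < i (Inl s))) + (\<Sum>t=1..l. of_bool (c < i (Inr t)) :: nat)" for c
  define X where "X = (\<Sum>t=1..k'. \<Sum>s=1..k. of_bool (i (Inl (k + t)) < i (Inl s)) :: nat)"
  define Y where "Y = (\<Sum>t=1..l'. \<Sum>s=1..l. of_bool (i (Inr (l + t)) < i (Inr s)) :: nat)"
  define Z where "Z = (\<Sum>t=1..l'. \<Sum>s=1..k. of_bool (i (Inr (l + t)) < i (Inl s)) :: nat)"
  have "even (\<Sum>x\<in>points k l. of_bool (c < i x) :: nat)" for c
    by (rule even_sum_even_colouring[OF _ even(1)]) auto
  then have "even ((\<Sum>s=1..k. of_bool (c < i (Inl s))) + (\<Sum>t=1..l. of_bool (c < i (Inr t)) :: nat))" for c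
    by (simp only: sum_points)
  then have "even (\<Sum>t=1..l'. (\<Sum>s=1..k. of_bool (i (Inr (l + t)) < i (Inl s)))
      + (\<Sum>s=1..l. of_bool (i (Inr (l + t)) < i (Inr s)) :: nat))"
    by (intro dvd_sum)
  then have "even (Z + Y)"
    by (simp only: Y_def Z_def sum.distrib)
  moreover have "even (\<Sum>x\<in>points k' l'. \<Sum>s=1..k. of_bool (?i' x < i (Inl s)) :: nat)"
    by (rule even_sum_even_colouring[OF _ even(2)]) auto
  then have "even (X + Z)"
    by (simp only: sum_points X_def Z_def comp_apply map_sum.simps)
  ultimately have XY: "even (X + Y)" by presburger
  have shift: "(i \<circ> Inl) \<circ> (+) k = ?i' \<circ> Inl" "(i \<circ> Inr) \<circ> (+) l = ?i' \<circ> Inr"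
    by auto
  have "inversions (k + k') (i \<circ> Inl) + inversions (l + l') (i \<circ> Inr) =
      (inversions k (i \<circ> Inl) + inversions l (i \<circ> Inr)) +
      (inversions k' (?i' \<circ> Inl) + inversions l' (?i' \<circ> Inr)) + (X + Y)"
    unfolding inversions_add shift X_def Y_def comp_apply by simp
  moreover have "(-1) ^ (a + b + (X + Y)) = (-1) ^ a * ((-1) ^ b :: complex)" for a b
    using XY by (simp add: minus_one_power_iff)
  ultimately show "twist_sign (k + k') (l + l') i = twist_sign k l i * twist_sign k' l' ?i'"
    unfolding twist_sign_def if_P[OF whole] if_P[OF even(1)] if_P[OF even(2)] by (simp only:)
qed


section \<open>The twist automorphism\<close>

lemma tensor_in_Part:
  "f \<in> Part k l \<Longrightarrow> g \<in> Part k' l' \<Longrightarrow> tensor k l f g \<in> Part (k + k') (l + l')"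
  unfolding Part_eq_supported by (erule (1) tensor_in_supported, rule tensor_partition_in_partitions)

lemma composition_in_Part: "f \<in> Part k l \<Longrightarrow> g \<in> Part l m \<Longrightarrow> composition \<delta> g f \<in> Part k m"
  unfolding Part_eq_supported by (erule (1) composition_in_supported, rule comp_partition_in_partitions)

lemma invol_in_Part: "f \<in> Part k l \<Longrightarrow> invol f \<in> Part l k"
  unfolding Part_eq_supported by (erule invol_in_supported, rule invol_partition_in_partitions)

lemma subspace_Part: "lincomb.subspace (Part k l)"
  unfolding Part_eq_supported by (rule subspace_supported)

text \<open>The sign is 0 on colourings that are not even, so these are the elements on which
  multiplication by the sign loses no information.\<close>

definition even_part :: "nat \<Rightarrow> nat \<Rightarrow> lincomb set" where
  "even_part k l = {f \<in> Part k l. \<forall>i. \<not> even_colouring (points k l) i \<longrightarrow> ev f i = 0}"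

lemma even_partD: "f \<in> even_part k l \<Longrightarrow> f \<in> Part k l"
  "f \<in> even_part k l \<Longrightarrow> \<not> even_colouring (points k l) i \<Longrightarrow> ev f i = 0"
  by (simp_all add: even_part_def)

lemma subspace_even_part: "lincomb.subspace (even_part k l)"
  using subspace_Part[of k l]
  by (auto simp: even_part_def lincomb.subspace_def ev_add ev_scale)

definition twist :: "nat \<Rightarrow> nat \<Rightarrow> lincomb \<Rightarrow> lincomb" where
  "twist k l f = (THE g. g \<in> Part k l \<and> (\<forall>i. ev g i = twist_sign k l i * ev f i))"

text \<open>The sign and the evaluation of \<open>f\<close> depend only on the kernel of the
  colouring, so their product is the evaluation of an element of \<open>Part\<close>, and of only
  one.\<close>

lemma twist:
  assumes "f \<in> Part k l"
  shows "twist k l f \<in> Part k l \<and> (\<forall>i. ev (twist k l f) i = twist_sign k l i * ev f i)"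
  unfolding twist_def
proof (rule theI')
  have "\<exists>g\<in>Part k l. \<forall>i. ev g i = twist_sign k l i * ev f i"
    using twist_sign_same_kernel ev_same_kernel[OF assms] by (intro ev_surj) metis
  then show "\<exists>!g. g \<in> Part k l \<and> (\<forall>i. ev g i = twist_sign k l i * ev f i)"
    by (metis ev_inject)
qed

lemmas twist_in_Part = twist[THEN conjunct1]
lemmas ev_twist = twist[THEN conjunct2, rule_format]

lemma twist_eqI:
  assumes "f \<in> Part k l" "g \<in> Part k l" "\<And>i. ev g i = twist_sign k l i * ev f i"
  shows "twist k l f = g"
  by (rule ev_inject[OF twist_in_Part[OF assms(1)] assms(2)]) (simp only: ev_twist[OF assms(1)] assms(3))

lemma twist_in_even_part: "f \<in> Part k l \<Longrightarrow> twist k l f \<in> even_part k l"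
  by (simp add: even_part_def twist_in_Part ev_twist twist_sign_def)

text \<open>The sign squares to 1 on even colourings, and \<open>f\<close> vanishes on all
  others.\<close>

lemma twist_twist:
  assumes "f \<in> even_part k l"
  shows "twist k l (twist k l f) = f"
proof (rule twist_eqI)
  note f = even_partD[OF assms]
  show "twist k l f \<in> Part k l" "f \<in> Part k l"
    using f(1) twist_in_Part by auto
  show "ev f i = twist_sign k l i * ev (twist k l f) i" for i
  proof (cases "even_colouring (points k l) i")
    case True
    then show ?thesis
      by (simp only: ev_twist[OF f(1)] twist_sign_square mult_1_left flip: mult.assoc)
  next
    case False
    then show ?thesis
      by (simp only: ev_twist[OF f(1)] f(2)[OF False] mult_zero_right)
  qed
qed

lemma twist_add:
  assumes "f \<in> Part k l" "g \<in> Part k l"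
  shows "twist k l (f + g) = twist k l f + twist k l g"
  using assms
  by (intro twist_eqI lincomb.subspace_add[OF subspace_Part] twist_in_Part)
    (simp_all add: ev_add ev_twist distrib_left)

lemma twist_scale:
  assumes "f \<in> Part k l"
  shows "twist k l (scale c f) = scale c (twist k l f)"
  using assms
  by (intro twist_eqI lincomb.subspace_scale[OF subspace_Part] twist_in_Part)
    (simp_all add: ev_scale ev_twist)

lemma tensor_in_even_part:
  assumes "f \<in> even_part k l" "g \<in> even_part k' l'"
  shows "tensor k l f g \<in> even_part (k + k') (l + l')"
  unfolding even_part_def
proof (intro CollectI conjI allI impI)
  show "tensor k l f g \<in> Part (k + k') (l + l')"
    using assms by (intro tensor_in_Part even_partD)
  fix i :: "nat + nat \<Rightarrow> nat"
  assume "\<not> even_colouring (points (k + k') (l + l')) i"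
  then show "ev (tensor k l f g) i = 0"
    using assms[THEN even_partD(2)] even_colouring_tensor unfolding ev_tensor by fastforce
qed

lemma twist_tensor:
  assumes "f \<in> even_part k l" "g \<in> even_part k' l'"
  shows "twist (k + k') (l + l') (tensor k l f g) = tensor k l (twist k l f) (twist k' l' g)"
proof (rule twist_eqI)
  note f = even_partD[OF assms(1)] and g = even_partD[OF assms(2)]
  show "tensor k l f g \<in> Part (k + k') (l + l')"
    by (rule tensor_in_Part[OF f(1) g(1)])
  show "tensor k l (twist k l f) (twist k' l' g) \<in> Part (k + k') (l + l')"
    by (rule tensor_in_Part[OF f(1)[THEN twist_in_Part] g(1)[THEN twist_in_Part]])
  fix i :: "nat + nat \<Rightarrow> nat"
  let ?i' = "i \<circ> map_sum ((+) k) ((+) l)"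
  show "ev (tensor k l (twist k l f) (twist k' l' g)) i =
      twist_sign (k + k') (l + l') i * ev (tensor k l f g) i"
  proof (cases "even_colouring (points k l) i \<and> even_colouring (points k' l') ?i'")
    case True
    then show ?thesis
      unfolding ev_tensor ev_twist[OF f(1)] ev_twist[OF g(1)] by (simp only: twist_sign_tensor mult_ac)
  next
    \<comment> \<open>The whole colouring may still be even without its sign factoring, but
      \<open>f\<close> or \<open>g\<close> vanishes on its part, so both sides are 0.\<close>
    case False
    then show ?thesis
      using f(2)[of i] g(2)[of ?i'] unfolding ev_tensor ev_twist[OF f(1)] ev_twist[OF g(1)] by auto
  qed
qed

lemma invol_in_even_part:
  assumes "f \<in> even_part k l"
  shows "invol f \<in> even_part l k"
  using even_partD[OF assms] invol_in_Part by (simp only: even_part_def mem_Collect_eq ev_invol)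
    (metis complex_cnj_zero even_colouring_swap_rows)

lemma twist_invol:
  assumes "f \<in> Part k l"
  shows "twist l k (invol f) = invol (twist k l f)"
  using assms
  by (intro twist_eqI invol_in_Part twist_in_Part) (simp_all add: ev_invol ev_twist twist_sign_swap_rows)

section \<open>Composition for arbitrary parameters\<close>

lemma poly_eq_of_eventually_nat:
  fixes P Q :: "complex poly"
  assumes "\<And>n. n \<ge> n0 \<Longrightarrow> poly P (of_nat n) = poly Q (of_nat n)"
  shows "P = Q"
proof (rule ccontr)
  assume "P \<noteq> Q"
  then have "finite {x. poly (P - Q) x = 0}"
    by (intro poly_roots_finite) simp
  moreover have "of_nat ` {n0..} \<subseteq> {x. poly (P - Q) x = 0}"
    using assms by auto
  ultimately have "finite ((of_nat :: nat \<Rightarrow> complex) ` {n0..})"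
    using finite_subset by blast
  then show False
    by (simp add: finite_image_iff inj_on_def infinite_Ici)
qed

lemma glue_outer: "glue l i b \<circ> map_sum id Inr = i"
proof
  fix x
  show "(glue l i b \<circ> map_sum id Inr) x = i x"
    by (cases x) (auto simp: glue_def middle_def)
qed

text \<open>For fixed \<open>i\<close>, both sides are polynomials in \<open>\<delta>\<close>, so it suffices to treat natural numbers
  \<open>\<delta>\<close> exceeding all colours, for which composition is the composition of the matrices \<open>ev f\<close>.\<close>

lemma
  assumes f: "f \<in> even_part k l" and g: "g \<in> even_part l m"
  shows ev_composition_twist: "ev (composition \<delta> (twist l m g) (twist k l f)) i =
      twist_sign k m i * ev (composition \<delta> g f) i" (is ?twist)
    and ev_composition_not_even: "\<not> even_colouring (points k m) i \<Longrightarrow> ev (composition \<delta> g f) i = 0"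
proof -
  note f' = even_partD[OF f] and g' = even_partD[OF g]
  obtain n0 where n0: "\<And>x. x \<in> points k m \<Longrightarrow> i x < n0"
    using finite_nat_set_iff_bounded[of "i ` points k m"] by auto
  obtain P where P: "\<And>\<delta>. ev (composition \<delta> g f) i = poly P \<delta>"
    using ev_composition_poly by blast
  obtain Q where Q: "\<And>\<delta>. ev (composition \<delta> (twist l m g) (twist k l f)) i = poly Q \<delta>"
    using ev_composition_poly by blast
  let ?a = "\<lambda>b. glue l i b \<circ> map_sum id Inl" and ?c = "\<lambda>b. glue l i b \<circ> Inr"
  have even: "even_colouring (points k m) i"
    if "even_colouring (points k l) (?a b)" "even_colouring (points l m) (?c b)" for b
    using even_colouring_compose[OF that] by (simp only: glue_outer)
  have sgn: "twist_sign k l (?a b) * twist_sign l m (?c b) = twist_sign k m i"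
    if "even_colouring (points k l) (?a b)" "even_colouring (points l m) (?c b)" for b
    using twist_sign_compose[OF that] by (simp only: glue_outer)
  \<comment> \<open>The identity holds for each middle row separately: either both glued colourings
    are even and the signs multiply, or one evaluation vanishes.\<close>
  have summand: "ev (twist k l f) (?a b) * ev (twist l m g) (?c b) =
      twist_sign k m i * (ev f (?a b) * ev g (?c b))" for b
  proof (cases "even_colouring (points k l) (?a b) \<and> even_colouring (points l m) (?c b)")
    case True
    then have "twist_sign k m i = twist_sign k l (?a b) * twist_sign l m (?c b)"
      using sgn by simp
    then show ?thesis
      by (simp only: ev_twist[OF f'(1)] ev_twist[OF g'(1)] mult_ac)
  next
    case False
    then show ?thesis
      using f'(2)[of "?a b"] g'(2)[of "?c b"] unfolding ev_twist[OF f'(1)] ev_twist[OF g'(1)] by auto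
  qed
  have ev_composition_nat: "ev (composition (of_nat n) h' h) i =
      (\<Sum>b\<in>middle l \<rightarrow>\<^sub>E {..<n}. ev h (?a b) * ev h' (?c b))"
    if "h \<in> Part k l" "h' \<in> Part l m" "n \<ge> n0" for h h' n
  proof (rule ev_composition_of_nat[OF that(1,2)])
    show "i x < n" if "x \<in> points k m" for x
      using n0[OF that] \<open>n \<ge> n0\<close> by simp
  qed
  have "poly Q (of_nat n) = poly (smult (twist_sign k m i) P) (of_nat n)" if "n \<ge> n0" for n
  proof -
    note ev_comp = ev_composition_nat[OF _ _ that]
    show ?thesis
      unfolding poly_smult P[symmetric] Q[symmetric] ev_comp[OF f'(1) g'(1)]
        ev_comp[OF twist_in_Part[OF f'(1)] twist_in_Part[OF g'(1)]] summand sum_distrib_left ..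
  qed
  then have "Q = smult (twist_sign k m i) P"
    by (rule poly_eq_of_eventually_nat)
  then show ?twist
    unfolding P Q by simp
  assume not_even: "\<not> even_colouring (points k m) i"
  have "poly P (of_nat n) = poly 0 (of_nat n)" if "n \<ge> n0" for n
  proof -
    note ev_comp = ev_composition_nat[OF _ _ that]
    \<comment> \<open>If both glued colourings were even, the outer colouring would be even as well;
      so one factor vanishes for every middle row.\<close>
    have zero: "ev f (?a b) * ev g (?c b) = 0" for b
      using not_even even[of b] f'(2)[of "?a b"] g'(2)[of "?c b"] by auto
    show ?thesis
      unfolding P[symmetric] ev_comp[OF f'(1) g'(1)] by (simp only: zero sum.neutral_const poly_0)
  qed
  then have "P = 0"
    by (rule poly_eq_of_eventually_nat)
  then show "ev (composition \<delta> g f) i = 0"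
    unfolding P by simp
qed

lemma composition_in_even_part:
  assumes "f \<in> even_part k l" "g \<in> even_part l m"
  shows "composition \<delta> g f \<in> even_part k m"
  unfolding even_part_def[of k m]
  using ev_composition_not_even[OF assms] composition_in_Part[OF assms[THEN even_partD(1)]]
  by blast

lemma twist_composition:
  assumes "f \<in> even_part k l" "g \<in> even_part l m"
  shows "twist k m (composition \<delta> g f) = composition \<delta> (twist l m g) (twist k l f)"
proof -
  have "f \<in> Part k l" "g \<in> Part l m" using assms even_partD(1) by auto
  then show ?thesis
    by (intro twist_eqI composition_in_Part[where l = l] twist_in_Part ev_composition_twist[OF assms])
qed

section \<open>Twists of the small partitions\<close>

lemma card_Collect_eq_sum: "finite A \<Longrightarrow> card {x \<in> A. P x} = (\<Sum>x\<in>A. of_bool (P x))"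
  by (simp add: Int_def)

lemma points_1_1: "points 1 1 = {Inl 1, Inr 1}"
  and points_0_2: "points 0 2 = {Inr 1, Inr 2}"
  and points_2_2: "points 2 2 = {Inl 1, Inl 2, Inr 1, Inr 2}"
  by (auto simp: numeral_2_eq_2 le_Suc_eq)

lemma sum_1_to_2: "(\<Sum>s=1..2. h s) = h 1 + h (2 :: nat)"
  by (simp add: numeral_2_eq_2)

lemma even_colouring_1_1: "i (Inl 1) = i (Inr 1) \<Longrightarrow> even_colouring (points 1 1) i"
  unfolding even_colouring_points card_Collect_eq_sum[OF finite_atLeastAtMost] by simp

lemma even_colouring_0_2: "i (Inr 1) = i (Inr 2) \<Longrightarrow> even_colouring (points 0 2) i"
  unfolding even_colouring_points card_Collect_eq_sum[OF finite_atLeastAtMost] sum_1_to_2 by simp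

lemma even_colouring_2_2:
  "i (Inl 1) = i (Inr 2) \<Longrightarrow> i (Inl 2) = i (Inr 1) \<Longrightarrow> even_colouring (points 2 2) i"
  unfolding even_colouring_points card_Collect_eq_sum[OF finite_atLeastAtMost] sum_1_to_2 by simp

lemma identity_in_partitions: "{{Inl 1, Inr 1}} \<in> partitions 1 1"
  unfolding partitions_def points_1_1 by (auto simp: partition_on_def)

lemma pair_in_partitions: "{{Inr 1, Inr 2}} \<in> partitions 0 2"
  unfolding partitions_def points_0_2 by (auto simp: partition_on_def)

lemma crossing_in_partitions: "crossing \<in> partitions 2 2"
  unfolding partitions_def points_2_2 crossing_def
  by (auto simp: partition_on_def pairwise_def disjnt_def)

lemma four_block_in_partitions: "four_block \<in> partitions 2 2"
  unfolding partitions_def points_2_2 four_block_def by (auto simp: partition_on_def)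

lemma basis_in_Part_iff [simp]: "basis p \<in> Part k l \<longleftrightarrow> p \<in> partitions k l"
  by (simp add: Part_eq_supported)

lemma compatible_pair: "compatible i {{x, y}} \<longleftrightarrow> i x = i y"
  unfolding compatible_def by (metis insertE insertI1 insertI2 singletonD)

lemma compatible_crossing: "compatible i crossing \<longleftrightarrow> i (Inl 1) = i (Inr 2) \<and> i (Inl 2) = i (Inr 1)"
  by (auto simp: compatible_def crossing_def)

lemma compatible_four_block:
  "compatible i four_block \<longleftrightarrow> i (Inl 1) = i (Inr 2) \<and> i (Inl 2) = i (Inr 1) \<and> i (Inl 1) = i (Inl 2)"
  by (auto simp: compatible_def four_block_def)

lemma inversions_1: "inversions 1 a = 0"
  by (simp add: inversions_def)

lemma inversions_2: "inversions 2 a = of_bool (a 2 < a 1)"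
  by (simp add: numeral_2_eq_2 inversions_Suc)

lemma twist_identity: "twist 1 1 (basis {{Inl 1, Inr 1}}) = basis {{Inl 1, Inr 1}}"
proof (rule twist_eqI)
  show "ev (basis {{Inl 1, Inr 1}}) i = twist_sign 1 1 i * ev (basis {{Inl 1, Inr 1}}) i" for i
  proof (cases "compatible i {{Inl 1, Inr 1}}")
    case True
    then have eq: "i (Inl 1) = i (Inr 1)"
      by (simp only: compatible_pair)
    show ?thesis
      unfolding twist_sign_def if_P[OF even_colouring_1_1[of i, OF eq]] inversions_1 by (simp del: One_nat_def)
  qed (simp add: ev_basis)
qed (use identity_in_partitions in simp_all)

lemma twist_pair: "twist 0 2 (basis {{Inr 1, Inr 2}}) = basis {{Inr 1, Inr 2}}"
proof (rule twist_eqI)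
  show "ev (basis {{Inr 1, Inr 2}}) i = twist_sign 0 2 i * ev (basis {{Inr 1, Inr 2}}) i" for i
  proof (cases "compatible i {{Inr 1, Inr 2}}")
    case True
    then have eq: "i (Inr 1) = i (Inr 2)"
      by (simp only: compatible_pair)
    show ?thesis
      unfolding twist_sign_def if_P[OF even_colouring_0_2[of i, OF eq]] inversions_2 by (simp add: eq del: One_nat_def)
  qed (simp add: ev_basis)
qed (use pair_in_partitions in simp_all)

text \<open>A colouring compatible with the crossing has rows (a,b) and (b,a). If a = b there is no
  inversion and the values agree as 1 = 2 - 1; otherwise exactly one row is inverted and they agree
  as -1 = 0 - 1.\<close>

lemma twist_crossing: "twist 2 2 (basis crossing) = scale 2 (basis four_block) - basis crossing"
proof (rule twist_eqI)
  show "basis crossing \<in> Part 2 2" "scale 2 (basis four_block) - basis crossing \<in> Part 2 2"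
    using crossing_in_partitions four_block_in_partitions
    by (auto intro!: lincomb.subspace_diff[OF subspace_Part] lincomb.subspace_scale[OF subspace_Part])
  show "ev (scale 2 (basis four_block) - basis crossing) i = twist_sign 2 2 i * ev (basis crossing) i" for i
  proof (cases "compatible i crossing")
    case True
    then have eq: "i (Inl 1) = i (Inr 2)" "i (Inl 2) = i (Inr 1)"
      by (simp_all add: compatible_crossing)
    then show ?thesis
      unfolding twist_sign_def if_P[OF even_colouring_2_2[OF eq]]
      by (simp add: ev_diff ev_scale ev_basis compatible_crossing compatible_four_block inversions_2)
  next
    case False
    then have "\<not> compatible i four_block"
      unfolding compatible_crossing compatible_four_block by blast
    with False show ?thesis
      by (simp add: ev_diff ev_scale ev_basis)
  qed
qed

lemma twist_four_block: "twist 2 2 (basis four_block) = basis four_block"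
proof (rule twist_eqI)
  show "ev (basis four_block) i = twist_sign 2 2 i * ev (basis four_block) i" for i
  proof (cases "compatible i four_block")
    case True
    then have eq: "i (Inl 1) = i (Inr 2)" "i (Inl 2) = i (Inr 1)" "i (Inl 1) = i (Inl 2)"
      by (simp_all add: compatible_four_block)
    then show ?thesis
      unfolding twist_sign_def if_P[OF even_colouring_2_2[OF eq(1,2)]] by (simp add: inversions_2)
  qed (simp add: ev_basis)
qed (use four_block_in_partitions in simp_all)

lemma basis_crossing_in_even_part: "basis crossing \<in> even_part 2 2"
  using crossing_in_partitions even_colouring_2_2
  by (auto simp: even_part_def ev_basis compatible_crossing)

text \<open>The ambient category on which \<open>twist\<close> is an automorphism.\<close>

lemma linear_category_even_part: "linear_category \<delta> even_part"
  unfolding linear_category_def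
proof (intro conjI allI ballI)
  show "basis {{Inl 1, Inr 1}} \<in> even_part 1 1"
    \<comment> \<open>An element fixed by \<open>twist\<close> is even, because every twisted
      element is.\<close>
    by (rule twist_in_even_part[of "basis {{Inl 1, Inr 1}}" 1 1, unfolded twist_identity basis_in_Part_iff,
        OF identity_in_partitions])
  show "basis {{Inr 1, Inr 2}} \<in> even_part 0 2"
    by (rule twist_in_even_part[of "basis {{Inr 1, Inr 2}}" 0 2, unfolded twist_pair basis_in_Part_iff,
        OF pair_in_partitions])
qed (auto intro: subspace_even_part tensor_in_even_part composition_in_even_part invol_in_even_part
    dest: even_partD)

section \<open>Generated categories under the twist\<close>

lemma linear_categoryD:
  assumes "linear_category \<delta> K"
  shows "K k l \<subseteq> Part k l" and "lincomb.subspace (K k l)"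
    and "basis {{Inl 1, Inr 1}} \<in> K 1 1" and "basis {{Inr 1, Inr 2}} \<in> K 0 2"
    and "f \<in> K k l \<Longrightarrow> g \<in> K k' l' \<Longrightarrow> tensor k l f g \<in> K (k + k') (l + l')"
    and "f \<in> K k l \<Longrightarrow> h \<in> K l m \<Longrightarrow> composition \<delta> h f \<in> K k m"
    and "f \<in> K k l \<Longrightarrow> invol f \<in> K l k"
  using assms by (simp_all add: linear_category_def)

text \<open>The operations commute with \<open>twist\<close> on even elements, so closure is
  inherited from preimages; the identity and the pair partition are their own twists.\<close>

lemma linear_category_twist:
  assumes K: "linear_category \<delta> K" and even: "\<And>k l. K k l \<subseteq> even_part k l"
  shows "linear_category \<delta> (\<lambda>k l. twist k l ` K k l)"
proof -
  have Kev: "f \<in> even_part k l" "f \<in> Part k l" if "f \<in> K k l" for f k l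
    using that even even_partD(1) by blast+
  have sub: "lincomb.subspace (twist k l ` K k l)" for k l
  proof (rule lincomb.subspaceI)
    have K': "lincomb.subspace (K k l)"
      by (rule linear_categoryD(2)[OF K])
    have "twist k l 0 = 0"
      using twist_scale[of 0 k l 0] lincomb.subspace_0[OF subspace_Part] by simp
    then show "0 \<in> twist k l ` K k l"
      using lincomb.subspace_0[OF K'] by force
    show "x + y \<in> twist k l ` K k l" if xy: "x \<in> twist k l ` K k l" "y \<in> twist k l ` K k l" for x y
    proof -
      obtain x' y' where "x' \<in> K k l" "x = twist k l x'" "y' \<in> K k l" "y = twist k l y'"
        using xy by blast
      then show ?thesis
        using twist_add[of x' k l y'] lincomb.subspace_add[OF K', of x' y'] Kev(2) by (metis image_eqI)
    qed
    show "scale c x \<in> twist k l ` K k l" if x: "x \<in> twist k l ` K k l" for c x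
    proof -
      obtain x' where "x' \<in> K k l" "x = twist k l x'"
        using x by blast
      then show ?thesis
        using twist_scale[of x' k l c] lincomb.subspace_scale[OF K', of x' c] Kev(2) by (metis image_eqI)
    qed
  qed
  show ?thesis
    unfolding linear_category_def
  proof (intro conjI allI ballI sub)
    show "twist k l ` K k l \<subseteq> Part k l" for k l
      using Kev twist_in_Part by blast
    show "basis {{Inl 1, Inr 1}} \<in> twist 1 1 ` K 1 1"
      using imageI[OF linear_categoryD(3)[OF K], of "twist 1 1"] by (simp only: twist_identity)
    show "basis {{Inr 1, Inr 2}} \<in> twist 0 2 ` K 0 2"
      using imageI[OF linear_categoryD(4)[OF K], of "twist 0 2"] by (simp only: twist_pair)
    show "tensor k l f g \<in> twist (k + k') (l + l') ` K (k + k') (l + l')"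
      if fg: "f \<in> twist k l ` K k l" "g \<in> twist k' l' ` K k' l'" for k l k' l' f g
    proof -
      obtain f' g' where fg': "f' \<in> K k l" "f = twist k l f'" "g' \<in> K k' l'" "g = twist k' l' g'"
        using fg by blast
      then have "tensor k l f g = twist (k + k') (l + l') (tensor k l f' g')"
        using Kev by (simp add: twist_tensor)
      moreover have "tensor k l f' g' \<in> K (k + k') (l + l')"
        by (rule linear_categoryD(5)[OF K fg'(1,3)])
      ultimately show ?thesis by blast
    qed
    show "composition \<delta> g f \<in> twist k m ` K k m"
      if fg: "f \<in> twist k l ` K k l" "g \<in> twist l m ` K l m" for k l m f g
    proof -
      obtain f' g' where fg': "f' \<in> K k l" "f = twist k l f'" "g' \<in> K l m" "g = twist l m g'"
        using fg by blast
      then have "composition \<delta> g f = twist k m (composition \<delta> g' f')"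
        using Kev by (simp add: twist_composition[of f' k l g'])
      moreover have "composition \<delta> g' f' \<in> K k m"
        by (rule linear_categoryD(6)[OF K fg'(1,3)])
      ultimately show ?thesis by blast
    qed
    show "invol f \<in> twist l k ` K l k" if f: "f \<in> twist k l ` K k l" for k l f
    proof -
      obtain f' where f': "f' \<in> K k l" "f = twist k l f'"
        using f by blast
      then have "invol f = twist l k (invol f')"
        using Kev by (simp add: twist_invol)
      moreover have "invol f' \<in> K l k"
        by (rule linear_categoryD(7)[OF K f'(1)])
      ultimately show ?thesis by blast
    qed
  qed
qed

lemma generated_by_eq:
  "generated_by \<delta> k l f k' l' = \<Inter>{K k' l' | K. linear_category \<delta> K \<and> f \<in> K k l}"
proof -
  have "(\<forall>k' l'. (if k' = k \<and> l' = l then {f} else {}) \<subseteq> K k' l') \<longleftrightarrow> f \<in> K k l"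
    for K :: "nat \<Rightarrow> nat \<Rightarrow> lincomb set"
    by auto
  then show ?thesis
    by (simp only: generated_by_def generated_def)
qed

lemma generated_by_least:
  "linear_category \<delta> K \<Longrightarrow> f \<in> K k l \<Longrightarrow> generated_by \<delta> k l f k' l' \<subseteq> K k' l'"
  unfolding generated_by_eq by blast

lemma generator_in_generated_by: "f \<in> generated_by \<delta> k l f k l"
  unfolding generated_by_eq by blast

text \<open>The category \<open>M\<close> keeps the intersection from running over an empty family,
  which is how it stays inside \<open>Part\<close>.\<close>

lemma linear_category_generated_by:
  assumes "linear_category \<delta> M" "f \<in> M k l"
  shows "linear_category \<delta> (generated_by \<delta> k l f)"
proof -
  let ?K = "generated_by \<delta> k l f"
  have mem: "x \<in> ?K k' l' \<longleftrightarrow> (\<forall>K. linear_category \<delta> K \<longrightarrow> f \<in> K k l \<longrightarrow> x \<in> K k' l')" for x k' l'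
    unfolding generated_by_eq by blast
  have sub: "lincomb.subspace (K k' l')" if "linear_category \<delta> K" for K k' l'
    using that by (rule linear_categoryD(2))
  have "lincomb.subspace (?K k' l')" for k' l'
    by (rule lincomb.subspaceI)
      (simp_all add: mem lincomb.subspace_0 lincomb.subspace_add lincomb.subspace_scale sub)
  moreover have "?K k' l' \<subseteq> Part k' l'" for k' l'
    using generated_by_least[OF assms] linear_categoryD(1)[OF assms(1)] by blast
  moreover have "basis {{Inl 1, Inr 1}} \<in> ?K 1 1" "basis {{Inr 1, Inr 2}} \<in> ?K 0 2"
    unfolding mem by (intro allI impI linear_categoryD(3,4); assumption)+
  moreover have "tensor k1 l1 x y \<in> ?K (k1 + k2) (l1 + l2)" if "x \<in> ?K k1 l1" "y \<in> ?K k2 l2" for k1 l1 k2 l2 x y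
    using that linear_categoryD(5) unfolding mem by blast
  moreover have "composition \<delta> y x \<in> ?K k1 m1" if "x \<in> ?K k1 l1" "y \<in> ?K l1 m1" for k1 l1 m1 x y
    using that linear_categoryD(6) unfolding mem by blast
  moreover have "invol x \<in> ?K l1 k1" if "x \<in> ?K k1 l1" for k1 l1 x
    using that linear_categoryD(7) unfolding mem by blast
  ultimately show ?thesis
    unfolding linear_category_def by simp
qed

text \<open>Minimality gives one inclusion, since the twisted category contains the twisted
  generator. The same inclusion for the generator \<open>twist k l f\<close>, twisted once more,
  gives the other, because \<open>twist\<close> is an involution.\<close>

lemma twist_generated_by:
  assumes f: "f \<in> even_part k l"
  shows "twist k' l' ` generated_by \<delta> k l f k' l' = generated_by \<delta> k l (twist k l f) k' l'"
proof -
  have le: "generated_by \<delta> k l (twist k l h) k' l' \<subseteq> twist k' l' ` generated_by \<delta> k l h k' l'"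
    if h: "h \<in> even_part k l" for h
  proof (rule generated_by_least)
    have "generated_by \<delta> k l h a b \<subseteq> even_part a b" for a b
      using generated_by_least[OF linear_category_even_part h] .
    then show "linear_category \<delta> (\<lambda>k' l'. twist k' l' ` generated_by \<delta> k l h k' l')"
      by (rule linear_category_twist[OF linear_category_generated_by[OF linear_category_even_part h]])
    show "twist k l h \<in> twist k l ` generated_by \<delta> k l h k l"
      using generator_in_generated_by by blast
  qed
  have tf: "twist k l f \<in> even_part k l"
    using twist_in_even_part[OF even_partD(1)[OF f]] .
  have "twist k' l' ` generated_by \<delta> k l f k' l' \<subseteq> twist k' l' ` twist k' l' ` generated_by \<delta> k l (twist k l f) k' l'"
    using le[OF tf] unfolding twist_twist[OF f] by (rule image_mono)
  also have "\<dots> = generated_by \<delta> k l (twist k l f) k' l'"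
    using generated_by_least[OF linear_category_even_part tf, of \<delta> k' l'] twist_twist
    by (force simp: image_image)
  finally show ?thesis
    using le[OF f] by blast
qed

text \<open>The isomorphism is the restriction of \<open>twist\<close>, which is injective as its
  own inverse on even elements.\<close>

lemma isomorphic_twist:
  assumes f: "f \<in> even_part k l"
  shows "isomorphic \<delta> (generated_by \<delta> k l (twist k l f)) (generated_by \<delta> k l f)"
proof -
  let ?K = "generated_by \<delta> k l (twist k l f)"
  have tf: "twist k l f \<in> even_part k l"
    using twist_in_even_part[OF even_partD(1)[OF f]] .
  have Kev: "x \<in> even_part k' l'" "x \<in> Part k' l'" if "x \<in> ?K k' l'" for x k' l'
    using that generated_by_least[OF linear_category_even_part tf, of \<delta> k' l'] even_partD(1) by blast+
  have "inj_on (twist k' l') (?K k' l')" for k' l'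
    by (rule inj_on_inverseI[of _ "twist k' l'"]) (simp add: twist_twist Kev)
  then have "bij_betw (twist k' l') (?K k' l') (generated_by \<delta> k l f k' l')" for k' l'
    using twist_generated_by[OF tf, of k' l' \<delta>] twist_twist[OF f] by (simp add: bij_betw_def)
  then show ?thesis
    unfolding isomorphic_def
    by (intro exI[of _ twist] conjI allI ballI)
      (auto intro!: twist_add twist_scale twist_tensor twist_composition twist_invol intro: Kev)
qed


section \<open>Pair partitions\<close>

definition pair_partitions :: "nat \<Rightarrow> nat \<Rightarrow> two_row set" where
  "pair_partitions k l = {p \<in> partitions k l. \<forall>B\<in>p. card B = 2}"

text \<open>A saturated set is the disjoint union of the pairs inside it; it is applied to the part
  of a component covered by one of two stacked partitions.\<close>

lemma card_saturated_pairs: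
  assumes "finite X" "partition_on X p" "\<And>B. B \<in> p \<Longrightarrow> card B = 2"
    and "A \<subseteq> X" "\<And>B. B \<in> p \<Longrightarrow> B \<inter> A \<noteq> {} \<Longrightarrow> B \<subseteq> A"
  shows "card A = 2 * card {B \<in> p. B \<subseteq> A}"
proof -
  have U: "\<Union>{B \<in> p. B \<subseteq> A} = A"
  proof
    show "A \<subseteq> \<Union>{B \<in> p. B \<subseteq> A}"
    proof
      fix x assume "x \<in> A"
      then obtain B where "B \<in> p" "x \<in> B"
        using assms(2,4) by (auto simp: partition_on_def)
      then show "x \<in> \<Union>{B \<in> p. B \<subseteq> A}"
        using assms(5)[of B] \<open>x \<in> A\<close> by blast
    qed
  qed blast
  have D: "disjoint {B \<in> p. B \<subseteq> A}"
    by (rule pairwise_subset[OF partition_onD2[OF assms(2)]]) simp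
  have "partition_on A {B \<in> p. B \<subseteq> A}"
    unfolding partition_on_def using partition_onD3[OF assms(2)] by (intro conjI U D) simp
  then have "card A = (\<Sum>B\<in>{B \<in> p. B \<subseteq> A}. card B)"
    by (rule product_partition) (use finite_subset[OF assms(4,1)] finite_subset in blast)
  then show ?thesis
    using assms(3) by simp
qed

lemma card_sum_type:
  assumes "finite A"
  shows "card A = card (Inl -` A) + card (Inr -` A)"
proof -
  have "A = Inl -` A <+> Inr -` A"
  proof (intro set_eqI)
    show "x \<in> A \<longleftrightarrow> x \<in> Inl -` A <+> Inr -` A" for x
      by (cases x) auto
  qed
  moreover have "finite (Inl -` A)" "finite (Inr -` A)"
    using assms by (auto intro: finite_vimageI)
  ultimately show ?thesis
    using card_Plus by metis
qed

text \<open>Let a component of the stacked diagram have \<open>u\<close> upper, \<open>d\<close> middle and \<open>w\<close> lower points.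
  It contains \<open>(u + d)/2\<close> pairs of \<open>p\<close> and \<open>(d + w)/2\<close> pairs of \<open>q\<close>, so connectedness
  gives \<open>u + d + w \<le> (u + d)/2 + (d + w)/2 + 1\<close>, that is \<open>u + w \<le> 2\<close>.\<close>

lemma comp_partition_in_pair_partitions:
  assumes "p \<in> pair_partitions k l" "q \<in> pair_partitions l m"
  shows "comp_partition q p \<in> pair_partitions k m"
proof -
  have p: "p \<in> partitions k l" "\<And>B. B \<in> p \<Longrightarrow> card B = 2"
    and q: "q \<in> partitions l m" "\<And>B. B \<in> q \<Longrightarrow> card B = 2"
    using assms by (auto simp: pair_partitions_def)
  let ?up = "map_sum id Inl :: nat + nat \<Rightarrow> nat + (nat + nat)"
  let ?Z = "{1..k} <+> ({1..l} <+> {1..m})"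
  have inj: "inj ?up"
    by (intro sum.inj_map) auto
  have "card B = 2" if B: "B \<in> comp_partition q p" for B
  proof -
    obtain C where C: "C \<in> merge (stack q p)" "B = map_sum id Inr -` C" "B \<noteq> {}"
      using B by (auto simp: comp_partition_def components_eq_merge)
    have CZ: "C \<subseteq> ?Z"
      using partition_on_components[OF p(1) q(1)] C(1) by (auto simp: partition_on_def components_eq_merge)
    have finC: "finite C"
      using CZ by (rule finite_subset) auto
    have finS: "finite (\<Union>(stack q p))"
      unfolding Union_stack[OF p(1) q(1)] by auto
    define u d w where "u = card (Inl -` C)" and "d = card (Inl -` Inr -` C)" and "w = card (Inr -` Inr -` C)"
    have fin: "finite (Inr -` C)" "finite (?up -` C)" "finite B"
      using finC inj C(2) by (auto intro!: finite_vimageI sum.inj_map)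
    have cardC: "card C = u + d + w"
      unfolding u_def d_def w_def using card_sum_type[OF finC] card_sum_type[OF fin(1)] by simp
    have rows: "Inl -` ?up -` C = Inl -` C" "Inr -` ?up -` C = Inl -` Inr -` C"
      "Inl -` map_sum id Inr -` C = Inl -` C" "Inr -` map_sum id Inr -` C = Inr -` Inr -` C"
      by auto
    have cardB: "card B = u + w"
      using card_sum_type[OF fin(3)] unfolding C(2) rows u_def w_def .
    define P where "P = {B \<in> p. B \<subseteq> ?up -` C}"
    define Q where "Q = {B \<in> q. B \<subseteq> Inr -` C}"
    have stack_mem: "?up ` B \<in> stack q p" if "B \<in> p" for B
      using that by (simp add: stack_def)
    have stack_mem': "Inr ` B \<in> stack q p" if "B \<in> q" for B
      using that by (simp add: stack_def)
    have "card (?up -` C) = 2 * card P"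
      unfolding P_def
    proof (rule card_saturated_pairs[of "points k l"])
      show "?up -` C \<subseteq> points k l"
      proof
        fix x assume "x \<in> ?up -` C"
        then show "x \<in> points k l" using CZ by (cases x) auto
      qed
      show "B \<subseteq> ?up -` C" if "B \<in> p" "B \<inter> ?up -` C \<noteq> {}" for B
        using merge_absorb[OF C(1) stack_mem[OF that(1)]] that(2) by blast
    qed (use p in \<open>auto simp: partitions_def\<close>)
    then have P: "u + d = 2 * card P"
      using card_sum_type[OF fin(2)] unfolding rows u_def d_def by simp
    have "card (Inr -` C) = 2 * card Q"
      unfolding Q_def
    proof (rule card_saturated_pairs[of "points l m"])
      show "Inr -` C \<subseteq> points l m"
        using CZ by auto
      show "B \<subseteq> Inr -` C" if "B \<in> q" "B \<inter> Inr -` C \<noteq> {}" for B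
        using merge_absorb[OF C(1) stack_mem'[OF that(1)]] that(2) by blast
    qed (use q in \<open>auto simp: partitions_def\<close>)
    then have Q: "d + w = 2 * card Q"
      using card_sum_type[OF fin(1)] unfolding d_def w_def by simp
    have finPQ: "finite P" "finite Q"
      unfolding P_def Q_def using p(1) q(1) finite_elements[of "points k l" p] finite_elements[of "points l m" q]
      by (simp_all add: partitions_def)
    have "{B \<in> stack q p. B \<subseteq> C} = (`) ?up ` P \<union> (`) Inr ` Q"
      unfolding stack_def P_def Q_def image_subset_iff_subset_vimage[symmetric] by blast
    then have "card {B \<in> stack q p. B \<subseteq> C} \<le> card ((`) ?up ` P) + card ((`) (Inr :: _ \<Rightarrow> nat + (nat + nat)) ` Q)"
      by (simp only: card_Un_le)
    also have "\<dots> \<le> card P + card Q"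
      using finPQ by (intro add_mono card_image_le)
    finally have "card {B \<in> stack q p. B \<subseteq> C} \<le> card P + card Q" .
    moreover have "card C \<le> card {B \<in> stack q p. B \<subseteq> C} + 1"
    proof (rule card_merge_block_le[OF finS _ C(1)])
      fix B assume "B \<in> stack q p"
      then show "card B \<le> 2"
        unfolding stack_def using p(2) q(2) card_image_le[of _ ?up] card_image_le[of _ Inr]
        by (auto simp: card_image inj_on_subset[OF inj])
    qed
    moreover have "card B \<noteq> 0"
      using C(3) fin(3) by simp
    \<comment> \<open>Besides being at most 2, \<open>u + w\<close> is even because
      \<open>u + d\<close> and \<open>d + w\<close> are, and it is nonzero, so it equals 2.\<close>
    ultimately show ?thesis
      using P Q cardB cardC by presburger
  qed
  then show ?thesis
    using comp_partition_in_partitions[OF p(1) q(1)] by (simp add: pair_partitions_def)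
qed

lemma tensor_partition_in_pair_partitions:
  assumes "p \<in> pair_partitions k l" "q \<in> pair_partitions k' l'"
  shows "tensor_partition k l p q \<in> pair_partitions (k + k') (l + l')"
proof -
  have "card (map_sum ((+) k) ((+) l) ` B) = card B" for B
    by (intro card_image inj_on_subset[OF sum.inj_map]) auto
  then show ?thesis
    using assms tensor_partition_in_partitions
    by (auto simp: pair_partitions_def tensor_partition_def)
qed

lemma invol_partition_in_pair_partitions:
  assumes "p \<in> pair_partitions k l"
  shows "invol_partition p \<in> pair_partitions l k"
proof -
  have "card (swap_rows ` B) = card B" for B
    by (intro card_image inj_on_subset[OF inj_swap_rows]) auto
  then show ?thesis
    using assms invol_partition_in_partitions
    by (auto simp: pair_partitions_def invol_partition_def simp flip: swap_rows_def)
qed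

text \<open>Supplies the upper bound on the category generated by the crossing.\<close>

lemma linear_category_pair_partitions:
  "linear_category \<delta> (\<lambda>k l. supported (pair_partitions k l))"
  unfolding linear_category_def
proof (intro conjI allI ballI)
  show "supported (pair_partitions k l) \<subseteq> Part k l" for k l
    by (auto simp: Part_eq_supported supported_def pair_partitions_def)
  show "basis {{Inl 1, Inr 1}} \<in> supported (pair_partitions 1 1)"
    using identity_in_partitions by (simp add: pair_partitions_def)
  show "basis {{Inr 1, Inr 2}} \<in> supported (pair_partitions 0 2)"
    using pair_in_partitions by (simp add: pair_partitions_def)
qed (erule tensor_in_supported composition_in_supported invol_in_supported | assumption
    | rule subspace_supported tensor_partition_in_pair_partitions comp_partition_in_pair_partitions
        invol_partition_in_pair_partitions)+

lemma crossing_in_pair_partitions: "crossing \<in> pair_partitions 2 2"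
  using crossing_in_partitions by (auto simp: pair_partitions_def crossing_def)

lemma four_block_not_in_pair_partitions: "four_block \<notin> pair_partitions 2 2"
  by (simp add: pair_partitions_def four_block_def)

section \<open>Non-easiness\<close>

lemma not_easy_twisted:
  "\<not> easy (generated_by \<delta> 2 2 (scale 2 (basis four_block) - basis crossing))"
proof
  let ?f = "scale 2 (basis four_block) - basis crossing"
  let ?K = "generated_by \<delta> 2 2 ?f"
  assume "easy ?K"
  then obtain C where C: "?K 2 2 = lincomb.span (basis ` C)"
    unfolding easy_def by blast
  \<comment> \<open>With each of its elements, a span of partitions contains every partition in the
    support of that element. Applied to \<open>?f\<close>, this puts \<open>four_block\<close> into
    the category.\<close>
  have "lincomb.span (basis ` C) \<subseteq> supported C"
    by (intro lincomb.span_minimal subspace_supported) auto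
  then have "?f \<in> supported C"
    using C generator_in_generated_by by blast
  moreover have "four_block \<noteq> crossing"
    using crossing_in_pair_partitions four_block_not_in_pair_partitions by metis
  then have "four_block \<in> Poly_Mapping.keys ?f"
    by (simp add: in_keys_iff lookup_minus lookup_single)
  ultimately have "basis four_block \<in> lincomb.span (basis ` C)"
    by (auto simp: supported_def intro: lincomb.span_base)
  \<comment> \<open>Twisting carries the category to the one generated by the crossing but leaves
    \<open>four_block\<close> in place, which would make the four-point block a combination of pair
    partitions.\<close>
  then have "twist 2 2 (basis four_block) \<in> twist 2 2 ` ?K 2 2"
    using C by simp
  also have "twist 2 2 ` ?K 2 2 = generated_by \<delta> 2 2 (basis crossing) 2 2"
    using twist_generated_by[OF twist_in_even_part, of "basis crossing" 2 2 2 2 \<delta>] crossing_in_partitions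
      twist_twist[OF basis_crossing_in_even_part]
    by (simp add: twist_crossing)
  also have "\<dots> \<subseteq> supported (pair_partitions 2 2)"
    by (rule generated_by_least[OF linear_category_pair_partitions])
      (simp add: crossing_in_pair_partitions)
  finally show False
    by (simp add: twist_four_block four_block_not_in_pair_partitions)
qed

theorem proposition6p8:
  fixes \<delta> :: complex
  shows "isomorphic \<delta>
           (generated_by \<delta> 2 2 (scale 2 (basis four_block) - basis crossing))
           (generated_by \<delta> 2 2 (basis crossing))
         \<and> \<not> easy (generated_by \<delta> 2 2 (scale 2 (basis four_block) - basis crossing))"
  using isomorphic_twist[OF basis_crossing_in_even_part, of \<delta>] not_easy_twisted
  by (simp only: twist_crossing simp_thms)

end
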